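(* Let $T>0$, $H\in(1/2,1)$, $\kappa,\theta\in\mathbb{R}$ with $\kappa\theta>0$, $\sigma>0$, $X_0>0$, and let $\{B(t)\}_{t\in[0,T]}$ be a fractional Brownian motion with Hurst parameter $H$. Let $\xi\in(0,1)$ and $p\ge 2$, and assume that $$\kappa\theta \exp\left(\frac{\kappa s}{2}\right) \ge (3p+1)\int_{0}^{s} \frac{\sigma^2}{2} \exp\left(\frac{\kappa \tau}{2}\right) \phi(\tau,s)\,d\tau, \qquad \forall\, 0\le s\le T,$$ where $\phi(\tau,s)=H(2H-1)|s-\tau|^{2H-2}$. Then for any step size $h=T/N$, $N\in\{1,2,\dots\}$, with $h\in(0,1)$ and $h\max\{0,-\kappa/2\}<1-\xi$, it holds that $$\left(\mathbb{E}\left[\sup_{0\le t\le T}|X(t)-X^h(t)|^p\right]\right)^{\frac1p}\le C(T,H,p,X_0,\kappa,\theta,\sigma,\xi)\,h^H\sqrt{\log \frac{T}{h}},$$ where $X(\cdot)$ is the exact solution of $$dX(t)=\frac12\kappa \left(\frac{\theta}{X(t)}-X(t)\right)dt+\frac12\sigma\, dB(t),\quad t\in(0,T],\qquad X(0)=X_0,$$ and $X^h$ is the piecewise linear interpolation of the backward Euler approximation: with $t_n=nh$ and $\Delta B_{n+1}=B(t_{n+1})-B(t_n)$, for $n=0,\dots,N-1$, $$X_{n+1}=\frac{X_n+\frac12\sigma\Delta B_{n+1}+\sqrt{\left(X_n+\frac12\sigma \Delta B_{n+1}\right)^2+\kappa h\theta (2+\kappa h)}}{2+\kappa h},$$ $$X^h(t)=X_n+\frac{t-t_n}{h}(X_{n+1}-X_n)\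 \text{ for } t\in(t_n,t_{n+1}],\qquad X^h(0)=X_0.$$
   Context: A fractional Brownian motion with Hurst parameter $H$ on a probability space $(\Omega,\mathcal{F},\mathbb{P})$ is a centered Gaussian process with continuous sample paths and covariance $\mathbb{E}[B(t)B(s)]=\frac12(t^{2H}+s^{2H}-|t-s|^{2H})$. The exact solution $X$ is the unique process with continuous, strictly positive paths satisfying almost surely, for all $t\in[0,T]$, the integral equation $X(t)=X_0+\int_0^t\frac12\kappa(\theta/X(s)-X(s))ds+\frac12\sigma B(t)$. The given formula for $X_{n+1}$ is the unique positive solution of the implicit relation $X_{n+1}=X_n+\frac12\kappa\left(\frac{\theta}{X_{n+1}}-X_{n+1}\right)h+\frac12\sigma\Delta B_{n+1}$, which exists whenever $h\max\{0,-\kappa/2\}<1$. The notation $C(\cdot)$ denotes a constant depending only on the listed parameters (in particular not on $h$ or $N$); $\log$ is the natural logarithm.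
   Formalization: N ≥ 2 is assumed instead of N ≥ 1: for N = 1 the bound is zero (log(T/h) = 0), which would force X to be a.s. affine, so the claim fails there; the constant is chosen for a fixed underlying set of sample points (one path space suffices by transfer of law). *)

theory Defs
  imports "HOL-Probability.Probability"
begin

text \<open>
  The second disjunct covers the degenerate (zero variance) normal distributions, which
  have no density; they occur here, for example, as the law of \<open>B 0\<close>.
\<close>

definition gaussian_rv :: "'a measure \<Rightarrow> ('a \<Rightarrow> real) \<Rightarrow> bool" where
  "gaussian_rv M Y \<longleftrightarrow> Y \<in> borel_measurable M \<and>
     (\<exists>\<mu>. (\<exists>s>0. distributed M lborel Y (normal_density \<mu> s)) \<or> (AE \<omega> in M. Y \<omega> = \<mu>))"

text \<open>
  The finite-dimensional distributions are multivariate normal, that is, all linear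
  combinations of the process at finitely many times are normal.
\<close>

definition gaussian_process :: "'a measure \<Rightarrow> real set \<Rightarrow> (real \<Rightarrow> 'a \<Rightarrow> real) \<Rightarrow> bool" where
  "gaussian_process M I Y \<longleftrightarrow>
     (\<forall>F c. finite F \<and> F \<subseteq> I \<longrightarrow> gaussian_rv M (\<lambda>\<omega>. \<Sum>t\<in>F. c t * Y t \<omega>))"

definition fractional_brownian_motion ::
    "'a measure \<Rightarrow> real \<Rightarrow> real \<Rightarrow> (real \<Rightarrow> 'a \<Rightarrow> real) \<Rightarrow> bool" where
  "fractional_brownian_motion M T H B \<longleftrightarrow>
     gaussian_process M {0..T} B \<and>
     (\<forall>t\<in>{0..T}. (LINT \<omega>|M. B t \<omega>) = 0) \<and>
     (\<forall>t\<in>{0..T}. \<forall>s\<in>{0..T}. (LINT \<omega>|M. B t \<omega> * B s \<omega>) =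
        (t powr (2 * H) + s powr (2 * H) - \<bar>t - s\<bar> powr (2 * H)) / 2) \<and>
     (\<forall>\<omega>\<in>space M. continuous_on {0..T} (\<lambda>t. B t \<omega>))"

text \<open>
  \<open>dX = (\<kappa>/2) (\<theta>/X - X) dt + (\<sigma>/2) dB\<close>, \<open>X 0 = X0\<close>. The noise is additive, so the equation
  is a pathwise integral equation and no stochastic integral is involved.
\<close>

definition exact_solution ::
    "'a measure \<Rightarrow> real \<Rightarrow> real \<Rightarrow> real \<Rightarrow> real \<Rightarrow> real \<Rightarrow> (real \<Rightarrow> 'a \<Rightarrow> real) \<Rightarrow> (real \<Rightarrow> 'a \<Rightarrow> real) \<Rightarrow> bool"
  where
  "exact_solution M T \<kappa> \<theta> \<sigma> X0 B X \<longleftrightarrow>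
     (\<forall>t\<in>{0..T}. X t \<in> borel_measurable M) \<and>
     (\<forall>\<omega>\<in>space M. continuous_on {0..T} (\<lambda>t. X t \<omega>) \<and> (\<forall>t\<in>{0..T}. X t \<omega> > 0)) \<and>
     (AE \<omega> in M. \<forall>t\<in>{0..T}.
        X t \<omega> = X0 + (LBINT s:{0..t}. 1/2 * \<kappa> * (\<theta> / X s \<omega> - X s \<omega>)) + 1/2 * \<sigma> * B t \<omega>)"

definition fbm_kernel :: "real \<Rightarrow> real \<Rightarrow> real \<Rightarrow> real" where
  "fbm_kernel H \<tau> s = H * (2 * H - 1) * \<bar>s - \<tau>\<bar> powr (2 * H - 2)"

text \<open>In the next two definitions \<open>b\<close> is a single path of the driving noise.\<close>

primrec backward_euler ::
    "real \<Rightarrow> real \<Rightarrow> real \<Rightarrow> real \<Rightarrow> real \<Rightarrow> (real \<Rightarrow> real) \<Rightarrow> nat \<Rightarrow> real" where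
  "backward_euler \<kappa> \<theta> \<sigma> X0 h b 0 = X0"
| "backward_euler \<kappa> \<theta> \<sigma> X0 h b (Suc n) =
     (let y = backward_euler \<kappa> \<theta> \<sigma> X0 h b n
              + 1/2 * \<sigma> * (b (real (Suc n) * h) - b (real n * h))
      in (y + sqrt (y\<^sup>2 + \<kappa> * h * \<theta> * (2 + \<kappa> * h))) / (2 + \<kappa> * h))"

text \<open>For \<open>t > 0\<close> the index \<open>n\<close> below is the one with \<open>n * h < t \<le> (n + 1) * h\<close>.\<close>

definition euler_interpolation ::
    "real \<Rightarrow> real \<Rightarrow> real \<Rightarrow> real \<Rightarrow> real \<Rightarrow> (real \<Rightarrow> real) \<Rightarrow> real \<Rightarrow> real" where
  "euler_interpolation \<kappa> \<theta> \<sigma> X0 h b t =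
     (if t = 0 then X0
      else let n = nat (\<lceil>t / h\<rceil> - 1); x = backward_euler \<kappa> \<theta> \<sigma> X0 h b
           in x n + (t - real n * h) / h * (x (Suc n) - x n))"

end

theory Submission
  imports Defs
begin

text \<open>
  The noise is additive, so the argument is pathwise. Gaussian increments satisfy
  \<open>E exp (Y\<^sup>2 / (4 Var Y)) = sqrt 2\<close>; a weighted sum of these exponentials over all dyadic
  refinements of a grid with \<open>N\<close> cells is a random variable \<open>G\<close> with \<open>E G \<le> 5\<close>, and chaining
  bounds the oscillation of \<open>B\<close> on the cells by a multiple of
  \<open>h powr H * sqrt (ln N) * (1 + ln G)\<close>. For \<open>N = 1\<close> the same functional controls a
  Hoelder norm of exponent \<open>\<gamma> \<in> {1/2<..<H}\<close>. Since \<open>\<gamma> > 1/2\<close>, the singular drift keeps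
  \<open>1 / X\<close> below a power of the Hoelder norm, so the drift is Lipschitz along the path with a constant
  polynomial in \<open>1 + ln G\<close>. The implicit scheme is monotone and inherits the local error, and all
  powers of \<open>1 + ln G\<close> are integrable because they are dominated by \<open>G\<close>.
\<close>

section \<open>Gaussian increments\<close>

text \<open>The drift blows up at 0 and has no global Lipschitz constant, so a lower bound for the
  path has to come before any error estimate. Only the exact path needs one: for the scheme
  positivity is enough, since the singular part of the drift is decreasing and damps the error. The
  functional is used at two scales. For \<open>N = 1\<close> it is turned into a Hoelder bound on
  all of \<open>{0..T}\<close>; its exponent \<gamma> < H would cost a factor
  \<open>h powr (\<gamma> - H)\<close> in the rate, so it is spent only on the size of
  \<open>X\<close> and \<open>1 / X\<close>. For the grid of the scheme it keeps the full power
  \<open>h powr H\<close> inside single cells. The union over the cells enters only through the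
  weight \<open>N\<close> of the exponentials, hence, once \<open>exp\<close> is inverted, as
  \<open>ln N\<close> under a square root; with \<open>N = T / h\<close> this is the logarithm in
  the rate. The bound 5 holds for every \<open>N\<close>, so the final constant does not see the
  step size.\<close>

lemma (in prob_space) gaussian_rv_square_integrable:
  assumes "gaussian_rv M Y"
  shows "integrable M (\<lambda>\<omega>. (Y \<omega>)\<^sup>2)" "integrable M Y"
proof -
  have m: "Y \<in> borel_measurable M" using assms by (simp add: gaussian_rv_def)
  obtain \<mu> where d: "(\<exists>s>0. distributed M lborel Y (normal_density \<mu> s)) \<or> (AE \<omega> in M. Y \<omega> = \<mu>)"
    using assms by (auto simp: gaussian_rv_def)
  have "integrable M (\<lambda>\<omega>. (Y \<omega>)\<^sup>2)"
  proof (cases "AE \<omega> in M. Y \<omega> = \<mu>")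
    case True
    then have "AE \<omega> in M. (Y \<omega>)\<^sup>2 = \<mu>\<^sup>2" by auto
    then have "integrable M (\<lambda>\<omega>. (Y \<omega>)\<^sup>2) \<longleftrightarrow> integrable M (\<lambda>\<omega>. \<mu>\<^sup>2)"
      using m by (intro integrable_cong_AE) auto
    then show ?thesis by simp
  next
    case False
    then obtain s where s: "s > 0" "distributed M lborel Y (normal_density \<mu> s)" using d by auto
    have i2: "integrable lborel (\<lambda>x. normal_density \<mu> s x * (x - \<mu>) ^ 2)"
      using integrable_normal_moment[OF s(1), of \<mu> 2] by simp
    have i1: "integrable lborel (\<lambda>x. normal_density \<mu> s x * (x - \<mu>) ^ 1)"
      using integrable_normal_moment[OF s(1), of \<mu> 1] by simp
    have i0: "integrable lborel (\<lambda>x. normal_density \<mu> s x)"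
      using s(1) by simp
    \<comment> \<open>Expansion of \<open>x\<^sup>2\<close> around \<mu>, which leaves only central
      moments.\<close>
    have "integrable lborel (\<lambda>x. normal_density \<mu> s x * (x - \<mu>) ^ 2 + 2 * \<mu> * (normal_density \<mu> s x * (x - \<mu>) ^ 1)
      + \<mu>\<^sup>2 * normal_density \<mu> s x)"
      by (intro Bochner_Integration.integrable_add integrable_mult_right i2 i1 i0)
    also have "(\<lambda>x. normal_density \<mu> s x * (x - \<mu>) ^ 2 + 2 * \<mu> * (normal_density \<mu> s x * (x - \<mu>) ^ 1)
      + \<mu>\<^sup>2 * normal_density \<mu> s x) = (\<lambda>x. normal_density \<mu> s x * x\<^sup>2)"
      by (auto simp: algebra_simps power2_eq_square)
    finally show ?thesis
      using distributed_integrable[OF s(2), of "\<lambda>x. x\<^sup>2"] by simp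
  qed
  then show "integrable M (\<lambda>\<omega>. (Y \<omega>)\<^sup>2)" .
  then show "integrable M Y" using m by (rule square_integrable_imp_integrable[rotated])
qed

lemma (in prob_space) gaussian_rv_exp_square:
  assumes g: "gaussian_rv M Y" and mean: "expectation Y = 0"
    and V: "expectation (\<lambda>\<omega>. (Y \<omega>)\<^sup>2) = V" "V > 0"
  shows "(\<integral>\<^sup>+\<omega>. ennreal (exp ((Y \<omega>)\<^sup>2 / (4 * V))) \<partial>M) = ennreal (sqrt 2)"
proof -
  have m: "Y \<in> borel_measurable M" using g by (simp add: gaussian_rv_def)
  obtain \<mu> where d: "(\<exists>s>0. distributed M lborel Y (normal_density \<mu> s)) \<or> (AE \<omega> in M. Y \<omega> = \<mu>)"
    using g by (auto simp: gaussian_rv_def)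
  have "\<not> (AE \<omega> in M. Y \<omega> = \<mu>)"
  proof
    assume a: "AE \<omega> in M. Y \<omega> = \<mu>"
    then have "expectation Y = expectation (\<lambda>_. \<mu>)"
      using m by (intro integral_cong_AE) auto
    then have "\<mu> = 0" using mean by (simp add: prob_space)
    with a have "AE \<omega> in M. (Y \<omega>)\<^sup>2 = 0" by auto
    then have "expectation (\<lambda>\<omega>. (Y \<omega>)\<^sup>2) = expectation (\<lambda>_. 0)"
      using m by (intro integral_cong_AE) auto
    then show False using V by simp
  qed
  then obtain s where s: "s > 0" "distributed M lborel Y (normal_density \<mu> s)" using d by auto
  have \<mu>: "\<mu> = 0" using normal_distributed_expectation[OF s(1) s(2)] mean by simp
  have s2: "V = s\<^sup>2" using normal_distributed_variance[OF s(1) s(2)] V mean by simp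
  have "(\<integral>\<^sup>+\<omega>. ennreal (exp ((Y \<omega>)\<^sup>2 / (4 * V))) \<partial>M)
     = (\<integral>\<^sup>+x. ennreal (normal_density \<mu> s x) * ennreal (exp (x\<^sup>2 / (4 * V))) \<partial>lborel)"
    by (rule distributed_nn_integral[OF s(2), symmetric]) simp
  also have "\<dots> = (\<integral>\<^sup>+x. ennreal (sqrt 2 * normal_density 0 (sqrt 2 * s) x) \<partial>lborel)"
  proof (rule nn_integral_cong)
    fix x
    have "normal_density 0 s x * exp (x\<^sup>2 / (4 * s\<^sup>2)) = sqrt 2 * normal_density 0 (sqrt 2 * s) x"
    proof -
      have e: "exp (- x\<^sup>2 / (2 * s\<^sup>2)) * exp (x\<^sup>2 / (4 * s\<^sup>2)) = exp (- x\<^sup>2 / (4 * s\<^sup>2))"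
        unfolding exp_add[symmetric] using s(1) by (auto simp: field_simps)
      have q: "sqrt (2 * pi * (sqrt 2 * s)\<^sup>2) = sqrt 2 * sqrt (2 * pi * s\<^sup>2)"
        by (simp add: power_mult_distrib real_sqrt_mult)
      have "sqrt 2 * normal_density 0 (sqrt 2 * s) x = 1 / sqrt (2 * pi * s\<^sup>2) * exp (- x\<^sup>2 / (4 * s\<^sup>2))"
        unfolding normal_density_def q by (simp add: power_mult_distrib)
      also have "\<dots> = normal_density 0 s x * exp (x\<^sup>2 / (4 * s\<^sup>2))"
        unfolding normal_density_def e[symmetric] by simp
      finally show ?thesis by simp
    qed
    then show "ennreal (normal_density \<mu> s x) * ennreal (exp (x\<^sup>2 / (4 * V)))
       = ennreal (sqrt 2 * normal_density 0 (sqrt 2 * s) x)"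
      by (simp add: \<mu> s2 ennreal_mult[symmetric])
  qed
  also have "\<dots> = ennreal (sqrt 2) * (\<integral>\<^sup>+x. ennreal (normal_density 0 (sqrt 2 * s) x) \<partial>lborel)"
    by (simp add: ennreal_mult nn_integral_cmult)
  also have "(\<integral>\<^sup>+x. ennreal (normal_density 0 (sqrt 2 * s) x) \<partial>lborel) = 1"
  proof -
    interpret D: prob_space "density lborel (normal_density 0 (sqrt 2 * s))"
      by (rule prob_space_normal_density) (use s in simp)
    show ?thesis using D.emeasure_space_1 by (simp add: emeasure_density)
  qed
  finally show ?thesis by simp
qed

section \<open>Fractional Brownian motion: increments and starting value\<close>

lemma fractional_brownian_motion_measurable:
  assumes "fractional_brownian_motion M T H B" "t \<in> {0..T}"
  shows "gaussian_rv M (B t)" "B t \<in> borel_measurable M"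
proof -
  have gp: "gaussian_process M {0..T} B" using assms(1) by (simp add: fractional_brownian_motion_def)
  show "gaussian_rv M (B t)"
    using gp[unfolded gaussian_process_def, rule_format, of "{t}" "\<lambda>_. 1"] assms(2) by simp
  then show "B t \<in> borel_measurable M" by (simp add: gaussian_rv_def)
qed

lemma (in prob_space) fractional_brownian_motion_increment:
  assumes f: "fractional_brownian_motion M T H B" and st: "s \<in> {0..T}" "t \<in> {0..T}"
    and "s \<noteq> t"
  shows "gaussian_rv M (\<lambda>\<omega>. B t \<omega> - B s \<omega>)" "expectation (\<lambda>\<omega>. B t \<omega> - B s \<omega>) = 0"
    "expectation (\<lambda>\<omega>. (B t \<omega> - B s \<omega>)\<^sup>2) = \<bar>t - s\<bar> powr (2 * H)"
proof -
  note F = f[unfolded fractional_brownian_motion_def]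
  have gp: "gaussian_process M {0..T} B" using F by simp
  \<comment> \<open>The coefficient function can tell the two times apart only because
    \<open>s \<noteq> t\<close>.\<close>
  show "gaussian_rv M (\<lambda>\<omega>. B t \<omega> - B s \<omega>)"
    using gp[unfolded gaussian_process_def, rule_format, of "{s,t}" "\<lambda>u. if u = t then 1 else -1"] st \<open>s \<noteq> t\<close>
    by simp
  note gs = gaussian_rv_square_integrable[OF fractional_brownian_motion_measurable(1)[OF f st(1)]]
  note gt = gaussian_rv_square_integrable[OF fractional_brownian_motion_measurable(1)[OF f st(2)]]
  show "expectation (\<lambda>\<omega>. B t \<omega> - B s \<omega>) = 0"
    using F gs gt st by simp
  have p: "integrable M (\<lambda>\<omega>. B t \<omega> * B s \<omega>)"
  proof (rule Bochner_Integration.integrable_bound)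
    show "integrable M (\<lambda>\<omega>. (B t \<omega>)\<^sup>2 + (B s \<omega>)\<^sup>2)" using gs gt by simp
    show "(\<lambda>\<omega>. B t \<omega> * B s \<omega>) \<in> borel_measurable M"
      using fractional_brownian_motion_measurable(2)[OF f] st by simp
    have "\<bar>x * y\<bar> \<le> x\<^sup>2 + y\<^sup>2" for x y :: real
      using sum_squares_bound[of "\<bar>x\<bar>" "\<bar>y\<bar>"] mult_nonneg_nonneg[OF abs_ge_zero abs_ge_zero, of x y]
      by (simp only: abs_mult power2_abs)
    then show "AE x in M. norm (B t x * B s x) \<le> norm ((B t x)\<^sup>2 + (B s x)\<^sup>2)" by simp
  qed
  have "(\<lambda>\<omega>. (B t \<omega> - B s \<omega>)\<^sup>2) = (\<lambda>\<omega>. (B t \<omega>)\<^sup>2 + (B s \<omega>)\<^sup>2 - 2 * (B t \<omega> * B s \<omega>))"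
    by (simp add: power2_diff algebra_simps)
  then have "expectation (\<lambda>\<omega>. (B t \<omega> - B s \<omega>)\<^sup>2)
    = expectation (\<lambda>\<omega>. (B t \<omega>)\<^sup>2) + expectation (\<lambda>\<omega>. (B s \<omega>)\<^sup>2) - 2 * expectation (\<lambda>\<omega>. B t \<omega> * B s \<omega>)"
    using gs gt p by simp
  also have "\<dots> = \<bar>t - s\<bar> powr (2 * H)"
  proof -
    have cov: "expectation (\<lambda>\<omega>. B u \<omega> * B v \<omega>) = (u powr (2 * H) + v powr (2 * H) - \<bar>u - v\<bar> powr (2 * H)) / 2"
      if "u \<in> {0..T}" "v \<in> {0..T}" for u v using F that by blast
    show ?thesis using cov[OF st(2,1)] cov[OF st(1,1)] cov[OF st(2,2)]
      by (simp add: power2_eq_square)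
  qed
  finally show "expectation (\<lambda>\<omega>. (B t \<omega> - B s \<omega>)\<^sup>2) = \<bar>t - s\<bar> powr (2 * H)" .
qed

text \<open>The definition does not prescribe the value at time 0. It comes from the covariance:
  \<open>0 powr (2 * H) = 0\<close> makes the second moment vanish, which fixes the value only
  almost surely.\<close>

lemma (in prob_space) fractional_brownian_motion_start:
  assumes f: "fractional_brownian_motion M T H B" and "0 \<le> T"
  shows "AE \<omega> in M. B 0 \<omega> = 0"
proof -
  have z: "0 \<in> {0..T}" using assms by simp
  have "expectation (\<lambda>\<omega>. B 0 \<omega> * B 0 \<omega>) = 0"
    using f z unfolding fractional_brownian_motion_def by fastforce
  then have "expectation (\<lambda>\<omega>. (B 0 \<omega>)\<^sup>2) = 0" by (simp add: power2_eq_square)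
  then show ?thesis
    using gaussian_rv_square_integrable(1)[OF fractional_brownian_motion_measurable(1)[OF f z]]
    by (subst (asm) integral_nonneg_eq_0_iff_AE) auto
qed

text \<open>The number \<open>g\<close> controls, for the partition into \<open>N\<close> cells and all of its dyadic
  refinements at once, the increments of \<open>b\<close> relative to the standard deviation of
  fractional Brownian motion.\<close>
definition dyadic_exp_bound :: "real \<Rightarrow> real \<Rightarrow> nat \<Rightarrow> (real \<Rightarrow> real) \<Rightarrow> real \<Rightarrow> bool" where
  "dyadic_exp_bound T H N b g \<longleftrightarrow> (\<forall>j. \<forall>i < N * 2 ^ j.
     exp ((b (real (Suc i) * (T / real (N * 2 ^ j))) - b (real i * (T / real (N * 2 ^ j))))\<^sup>2
        / (4 * (T / real (N * 2 ^ j)) powr (2 * H))) \<le> real N * 4 ^ j * g)"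

text \<open>Level j has \<open>N * 2 ^ j\<close> exponentials of mean \<open>sqrt 2\<close>.
  Dividing each by \<open>N * 4 ^ j\<close> leaves at most \<open>2 * (1 / 2) ^ j\<close> for the
  level and 4 for all levels, whatever \<open>N\<close> is. Every weighted exponential is at most
  the whole sum, so one random variable serves all cells of all levels.\<close>

lemma (in prob_space) fractional_brownian_motion_dyadic_exp_bound:
  assumes f: "fractional_brownian_motion M T H B" and "T > 0" and N: "N > 0"
  obtains G where "G \<in> borel_measurable M" "\<And>\<omega>. 1 \<le> G \<omega>" "integrable M G" "expectation G \<le> 5"
    "AE \<omega> in M. dyadic_exp_bound T H N (\<lambda>t. B t \<omega>) (G \<omega>)"
proof -
  define h where "h j = T / real (N * 2 ^ j)" for j
  define e where "e j i \<omega> = exp ((B (real (Suc i) * h j) \<omega> - B (real i * h j) \<omega>)\<^sup>2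
     / (4 * h j powr (2 * H)))" for j i \<omega>
  define S where "S j \<omega> = (\<Sum>i<N * 2 ^ j. ennreal (e j i \<omega> / (real N * 4 ^ j)))" for j \<omega>
  \<comment> \<open>The summand 1 keeps \<open>ln G\<close> nonnegative and turns the bound 4 into
    5. An infinite sum becomes 0 under \<open>enn2real\<close>, so the bound can be claimed only
    where the sum is finite.\<close>
  define G where "G \<omega> = 1 + enn2real (\<Sum>j. S j \<omega>)" for \<omega>
  have hpos: "h j > 0" for j using \<open>T > 0\<close> N by (simp add: h_def)
  have grid: "real i * h j \<in> {0..T}" if "i \<le> N * 2 ^ j" for i j
  proof -
    have "real i * h j \<le> real (N * 2 ^ j) * h j"
      using that hpos[of j] by (intro mult_right_mono) (simp_all only: of_nat_le_iff less_imp_le)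
    also have "\<dots> = T" using N by (simp add: h_def)
    finally show ?thesis using hpos[of j] by simp
  qed
  have em: "e j i \<in> borel_measurable M" if "i < N * 2 ^ j" for i j
  proof -
    have "B (real (Suc i) * h j) \<in> borel_measurable M" "B (real i * h j) \<in> borel_measurable M"
      using that by (auto intro!: fractional_brownian_motion_measurable(2)[OF f] grid simp del: of_nat_Suc)
    then show ?thesis unfolding e_def[abs_def] by measurable
  qed
  have ei: "(\<integral>\<^sup>+\<omega>. ennreal (e j i \<omega>) \<partial>M) \<le> 2" if i: "i < N * 2 ^ j" for i j
  proof -
    have d: "real (Suc i) * h j - real i * h j = h j" by (simp add: algebra_simps)
    then have ne: "real i * h j \<noteq> real (Suc i) * h j" using hpos[of j] by linarith
    note inc = fractional_brownian_motion_increment[OF f grid grid ne]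
    have "(\<integral>\<^sup>+\<omega>. ennreal (e j i \<omega>) \<partial>M) = ennreal (sqrt 2)"
      unfolding e_def
      using i hpos[of j] inc(3)[unfolded d] by (intro gaussian_rv_exp_square inc) (simp_all only: d abs_of_pos powr_gt_zero)
    also have "\<dots> \<le> ennreal 2" by (intro ennreal_leI) (simp add: real_le_lsqrt)
    finally show ?thesis by simp
  qed
  have Sm: "S j \<in> borel_measurable M" for j
    unfolding S_def[abs_def] using em by (intro borel_measurable_sum) simp
  have Si: "(\<integral>\<^sup>+\<omega>. S j \<omega> \<partial>M) \<le> ennreal (2 * (1 / 2) ^ j)" for j
  proof -
    have "(\<integral>\<^sup>+\<omega>. S j \<omega> \<partial>M) = (\<Sum>i<N * 2 ^ j. \<integral>\<^sup>+\<omega>. ennreal (e j i \<omega> / (real N * 4 ^ j)) \<partial>M)"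
      unfolding S_def using em by (intro nn_integral_sum) simp
    also have "\<dots> = (\<Sum>i<N * 2 ^ j. ennreal (1 / (real N * 4 ^ j)) * (\<integral>\<^sup>+\<omega>. ennreal (e j i \<omega>) \<partial>M))"
    proof (intro sum.cong refl)
      fix i assume i: "i \<in> {..<N * 2 ^ j}"
      have "(\<integral>\<^sup>+\<omega>. ennreal (e j i \<omega> / (real N * 4 ^ j)) \<partial>M)
         = (\<integral>\<^sup>+\<omega>. ennreal (1 / (real N * 4 ^ j)) * ennreal (e j i \<omega>) \<partial>M)"
        by (intro nn_integral_cong) (simp add: ennreal_mult[symmetric] e_def)
      also have "\<dots> = ennreal (1 / (real N * 4 ^ j)) * (\<integral>\<^sup>+\<omega>. ennreal (e j i \<omega>) \<partial>M)"
        using em i by (intro nn_integral_cmult) simp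
      finally show "(\<integral>\<^sup>+\<omega>. ennreal (e j i \<omega> / (real N * 4 ^ j)) \<partial>M)
         = ennreal (1 / (real N * 4 ^ j)) * (\<integral>\<^sup>+\<omega>. ennreal (e j i \<omega>) \<partial>M)" .
    qed
    also have "\<dots> \<le> (\<Sum>i<N * 2 ^ j. ennreal (1 / (real N * 4 ^ j)) * ennreal 2)"
      using ei by (intro sum_mono mult_left_mono) simp_all
    also have "\<dots> = ennreal (\<Sum>i<N * 2 ^ j. 1 / (real N * 4 ^ j) * 2)"
      by (simp only: ennreal_mult[symmetric] zero_le_numeral zero_le_divide_1_iff mult_nonneg_nonneg
          of_nat_0_le_iff zero_le_power sum_ennreal)
    also have "(\<Sum>i<N * 2 ^ j. 1 / (real N * 4 ^ j) * 2) = 2 * (1 / 2) ^ j"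
    proof -
      have "(4::real) ^ j = 2 ^ j * 2 ^ j" by (simp add: power_mult_distrib[symmetric])
      then show ?thesis using N by (simp add: power_one_over)
    qed
    finally show ?thesis .
  qed
  have tot: "(\<integral>\<^sup>+\<omega>. (\<Sum>j. S j \<omega>) \<partial>M) \<le> 4"
  proof -
    have "(\<integral>\<^sup>+\<omega>. (\<Sum>j. S j \<omega>) \<partial>M) = (\<Sum>j. \<integral>\<^sup>+\<omega>. S j \<omega> \<partial>M)"
      using Sm by (intro nn_integral_suminf)
    also have "\<dots> \<le> (\<Sum>j. ennreal (2 * (1 / 2) ^ j))"
      using Si by (intro suminf_le) auto
    also have "\<dots> = ennreal (\<Sum>j. 2 * (1 / 2) ^ j)"
      by (intro suminf_ennreal2) (auto intro!: summable_mult)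
    also have "(\<Sum>j. 2 * (1 / 2 :: real) ^ j) = 4"
      by (subst suminf_mult) (auto simp: suminf_geometric)
    finally show ?thesis by simp
  qed
  have Sum_m: "(\<lambda>\<omega>. \<Sum>j. S j \<omega>) \<in> borel_measurable M" using Sm by measurable
  have fin: "AE \<omega> in M. (\<Sum>j. S j \<omega>) \<noteq> \<infinity>"
    using tot by (intro nn_integral_PInf_AE Sum_m) (auto simp: top_unique)
  have Gm: "G \<in> borel_measurable M" unfolding G_def[abs_def] using Sum_m by measurable
  have nn: "(\<integral>\<^sup>+\<omega>. ennreal (G \<omega>) \<partial>M) \<le> 5"
  proof -
    have "(\<integral>\<^sup>+\<omega>. ennreal (G \<omega>) \<partial>M) = (\<integral>\<^sup>+\<omega>. 1 + (\<Sum>j. S j \<omega>) \<partial>M)"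
      using fin by (intro nn_integral_cong_AE) (auto simp: G_def less_top ennreal_plus ennreal_enn2real)
    also have "\<dots> = 1 + (\<integral>\<^sup>+\<omega>. (\<Sum>j. S j \<omega>) \<partial>M)"
      by (subst nn_integral_add) (auto simp: Sum_m emeasure_space_1)
    also have "\<dots> \<le> 1 + 4" using tot by (intro add_left_mono)
    finally show ?thesis by simp
  qed
  have G1: "1 \<le> G \<omega>" for \<omega> by (simp add: G_def)
  have Gi: "integrable M G"
  proof (rule integrableI_bounded[OF Gm])
    have "(\<integral>\<^sup>+ x. ennreal (norm (G x)) \<partial>M) = (\<integral>\<^sup>+ x. ennreal (G x) \<partial>M)"
      using G1 by (intro nn_integral_cong) (smt (verit) real_norm_def)
    then show "(\<integral>\<^sup>+ x. ennreal (norm (G x)) \<partial>M) < \<infinity>" using nn by (auto simp: le_less_trans)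
  qed
  have Ge: "expectation G \<le> 5"
  proof -
    have "ennreal (expectation G) = (\<integral>\<^sup>+\<omega>. ennreal (G \<omega>) \<partial>M)"
      using G1 by (intro nn_integral_eq_integral[symmetric] Gi AE_I2) (smt (verit))
    then have "ennreal (expectation G) \<le> ennreal 5" using nn by simp
    then show ?thesis by (subst (asm) ennreal_le_iff) auto
  qed
  have b: "AE \<omega> in M. dyadic_exp_bound T H N (\<lambda>t. B t \<omega>) (G \<omega>)"
    using fin
  proof eventually_elim
    case (elim \<omega>)
    have "e j i \<omega> \<le> real N * 4 ^ j * G \<omega>" if i: "i < N * 2 ^ j" for i j
    proof -
      have "ennreal (e j i \<omega> / (real N * 4 ^ j)) \<le> S j \<omega>"
        unfolding S_def using i by (intro member_le_sum) auto
      also have "\<dots> \<le> (\<Sum>j. S j \<omega>)"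
        using sum_le_suminf[of "\<lambda>j. S j \<omega>" "{j}"] by simp
      also have "\<dots> \<le> ennreal (G \<omega>)"
        using elim by (simp add: G_def ennreal_plus ennreal_enn2real less_top)
      finally have "e j i \<omega> / (real N * 4 ^ j) \<le> G \<omega>"
        using G1[of \<omega>] by (subst (asm) ennreal_le_iff) auto
      then show ?thesis using N by (simp add: field_simps)
    qed
    then show ?case unfolding dyadic_exp_bound_def e_def h_def by blast
  qed
  show thesis using that[OF Gm G1 Gi Ge b] .
qed

section \<open>Dyadic chaining\<close>

text \<open>Rounding s down to the grid of level j gives points that converge to s, and passing to
  the next level either keeps the point or moves it by one cell of the finer grid. Each level
  therefore costs at most one \<open>d j\<close>, and continuity of b carries the telescoped bound
  to the limit.\<close>

lemma dyadic_chaining: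
  fixes b d :: "_ \<Rightarrow> real"
  assumes "T > 0" and N: "N > 0" and cont: "continuous_on {0..T} b" and d: "summable d"
    and inc: "\<And>j i. i < N * 2 ^ j \<Longrightarrow>
      \<bar>b (real (Suc i) * (T / real (N * 2 ^ j))) - b (real i * (T / real (N * 2 ^ j)))\<bar> \<le> d j"
    and i: "i < N" and s: "real i * (T / real N) \<le> s" "s \<le> real (Suc i) * (T / real N)"
  shows "\<bar>b s - b (real i * (T / real N))\<bar> \<le> suminf d"
proof -
  define h where "h j = T / real (N * 2 ^ j)" for j
  have hpos: "h j > 0" for j using assms by (simp add: h_def)
  have h0: "h 0 = T / real N" by (simp add: h_def)
  have h2: "h j = 2 * h (Suc j)" for j using N by (simp add: h_def field_simps)
  have inc': "\<bar>b (real (Suc i) * h j) - b (real i * h j)\<bar> \<le> d j" if "i < N * 2 ^ j" for i j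
    using inc[OF that] by (simp add: h_def)
  have d0: "d j \<ge> 0" for j using inc'[of 0 j] N by (force intro: order_trans[OF abs_ge_zero])
  have sum_le: "(\<Sum>l<n. d l) \<le> suminf d" for n by (rule sum_le_suminf[OF d]) (auto simp: d0)
  show ?thesis
  \<comment> \<open>The right end point is treated apart: rounding down would put it into the next
    cell, and \<open>k 0 = i\<close> would fail.\<close>
  proof (cases "s = real (Suc i) * (T / real N)")
    case True
    have "\<bar>b s - b (real i * (T / real N))\<bar> \<le> d 0" using inc'[of i 0] i True by (simp add: h0)
    also have "\<dots> \<le> suminf d" using sum_le[of 1] by simp
    finally show ?thesis .
  next
    case False
    then have slt: "s < real (Suc i) * h 0" using s h0 by simp
    have s0: "0 \<le> s" using s hpos[of 0] h0 by (smt (verit) of_nat_0_le_iff mult_nonneg_nonneg)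
    have "real (Suc i) * h 0 \<le> real N * h 0" using i hpos[of 0] by (intro mult_right_mono) auto
    also have "\<dots> = T" using N by (simp add: h0)
    finally have sT: "s < T" using slt by simp
    define k where "k j = nat \<lfloor>s / h j\<rfloor>" for j
    have k: "real (k j) \<le> s / h j" "s / h j < real (k j) + 1" for j
      using s0 hpos[of j] by (auto simp: k_def)
    have kh: "real (k j) * h j \<le> s" "s < real (k j) * h j + h j" for j
      using k[of j] hpos[of j] by (auto simp: field_simps)
    have k0: "k 0 = i"
    proof -
      have "\<lfloor>s / h 0\<rfloor> = int i"
        using slt s(1)[folded h0] hpos[of 0]
        by (intro floor_unique) (simp_all add: pos_le_divide_eq pos_divide_less_eq algebra_simps)
      then show ?thesis by (simp add: k_def)
    qed
    have step: "\<bar>b (real (k (Suc j)) * h (Suc j)) - b (real (k j) * h j)\<bar> \<le> d (Suc j)" for j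
    proof -
      have *: "real (k j) * h j = real (2 * k j) * h (Suc j)" by (simp add: h2[of j])
      have p: "h (Suc j) > 0" by (rule hpos)
      have "real (2 * k j) * h (Suc j) < (real (k (Suc j)) + 1) * h (Suc j)"
        using kh(1)[of j] kh(2)[of "Suc j"] unfolding * by (simp add: algebra_simps)
      then have l: "2 * k j \<le> k (Suc j)" using p by (simp add: mult_less_cancel_right)
      have "real (k (Suc j)) * h (Suc j) < (real (2 * k j) + 2) * h (Suc j)"
        using kh(2)[of j] kh(1)[of "Suc j"] unfolding * by (simp add: h2[of j] algebra_simps)
      then have u: "k (Suc j) \<le> 2 * k j + 1" using p by (simp add: mult_less_cancel_right)
      have c: "k (Suc j) = 2 * k j \<or> k (Suc j) = Suc (2 * k j)" using l u by auto
      have "real (2 * k j) * h (Suc j) < real (N * 2 ^ Suc j) * h (Suc j)"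
        using kh(1)[of j] sT N unfolding * by (simp add: h_def)
      then have "2 * k j < N * 2 ^ Suc j" using p by (simp only: mult_less_cancel_right of_nat_less_iff)
      from inc'[OF this] c show ?thesis unfolding * using d0[of "Suc j"] by auto
    qed
    have tele: "\<bar>b (real (k n) * h n) - b (real i * h 0)\<bar> \<le> (\<Sum>l<Suc n. d l)" for n
    proof (induction n)
      case 0
      then show ?case using d0[of 0] by (simp add: k0)
    next
      case (Suc n)
      then show ?case using step[of n] by simp
    qed
    have lim: "(\<lambda>n. real (k n) * h n) \<longlonglongrightarrow> s"
    proof (rule tendsto_sandwich)
      show "\<forall>\<^sub>F n in sequentially. s - h 0 * (1 / 2) ^ n \<le> real (k n) * h n"
      proof (rule always_eventually, rule allI)
        fix n
        have "h n = h 0 * (1 / 2) ^ n" by (simp add: h_def power_one_over)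
        then show "s - h 0 * (1 / 2) ^ n \<le> real (k n) * h n" using kh(2)[of n] by simp
      qed
      show "\<forall>\<^sub>F n in sequentially. real (k n) * h n \<le> s" using kh(1) by simp
      have "(\<lambda>n. s - h 0 * (1 / 2) ^ n) \<longlonglongrightarrow> s - h 0 * 0"
        by (intro tendsto_intros LIMSEQ_power_zero) simp
      then show "(\<lambda>n. s - h 0 * (1 / 2) ^ n) \<longlonglongrightarrow> s" by simp
    qed simp
    have "(\<lambda>n. b (real (k n) * h n)) \<longlonglongrightarrow> b s"
    proof (rule continuous_on_tendsto_compose[OF cont lim])
      show "s \<in> {0..T}" using s0 sT by simp
      show "\<forall>\<^sub>F n in sequentially. real (k n) * h n \<in> {0..T}"
      proof (intro always_eventually allI)
        fix n
        show "real (k n) * h n \<in> {0..T}" using kh(1)[of n] sT hpos[of n] by simp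
      qed
    qed
    then have "(\<lambda>n. \<bar>b (real (k n) * h n) - b (real i * h 0)\<bar>) \<longlonglongrightarrow> \<bar>b s - b (real i * h 0)\<bar>"
      by (intro tendsto_intros)
    then have "\<bar>b s - b (real i * h 0)\<bar> \<le> suminf d"
      by (rule LIMSEQ_le_const2) (use tele sum_le in \<open>blast intro: order_trans\<close>)
    then show ?thesis by (simp add: h0)
  qed
qed

text \<open>Choose the level n whose mesh is at least \<open>t - s\<close> but less than twice as
  large. Then s and t lie in the same cell or in adjacent ones, and chaining inside the cells gives
  at most three oscillations, each bounded by a geometric tail starting at \<open>y ^ n\<close>. The
  comparison of \<open>y ^ n\<close> with \<open>(t - s) powr \<gamma>\<close> costs
  \<open>2 powr \<gamma> \<le> 2\<close>, whence the constant 6.\<close>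

lemma dyadic_holder:
  fixes b :: "real \<Rightarrow> real"
  assumes "T > 0" and cont: "continuous_on {0..T} b" and \<gamma>: "0 < \<gamma>" "\<gamma> \<le> 1" and "A \<ge> 0"
    and inc: "\<And>j i. i < 2 ^ j \<Longrightarrow>
      \<bar>b (real (Suc i) * (T / 2 ^ j)) - b (real i * (T / 2 ^ j))\<bar> \<le> A * (2 powr -\<gamma>) ^ j"
    and st: "s \<in> {0..T}" "t \<in> {0..T}"
  shows "\<bar>b t - b s\<bar> \<le> 6 * A / (1 - 2 powr -\<gamma>) * T powr -\<gamma> * \<bar>t - s\<bar> powr \<gamma>"
proof -
  define y where "y = 2 powr -\<gamma>"
  have y: "0 < y" "y < 1" using \<gamma> by (auto simp: y_def powr_minus inverse_less_1_iff)
  have main: "\<bar>b t - b s\<bar> \<le> 6 * A / (1 - y) * T powr -\<gamma> * (t - s) powr \<gamma>"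
    if st: "0 \<le> s" "s < t" "t \<le> T" for s t
  proof -
    have "\<exists>n. T / 2 ^ Suc n < t - s"
    proof -
      have "(t - s) / T > 0" using st \<open>T > 0\<close> by simp
      then obtain n where "(1/2) ^ n < (t - s) / T"
        using real_arch_pow_inv[of "(t - s) / T" "1/2"] by auto
      then have "T / 2 ^ n < t - s" using \<open>T > 0\<close> by (simp add: power_one_over field_simps)
      moreover have "T / 2 ^ Suc n \<le> T / 2 ^ n" using \<open>T > 0\<close> by (simp add: field_simps)
      ultimately show ?thesis by (meson le_less_trans)
    qed
    then obtain n where n: "T / 2 ^ Suc n < t - s" "\<And>m. m < n \<Longrightarrow> \<not> T / 2 ^ Suc m < t - s"
      using exists_least_iff[of "\<lambda>n. T / 2 ^ Suc n < t - s"] by blast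
    define h where "h = T / 2 ^ n"
    have hpos: "h > 0" using \<open>T > 0\<close> by (simp add: h_def)
    have tsh: "t - s \<le> h"
    proof (cases n)
      case 0 then show ?thesis using st by (simp add: h_def)
    next
      case (Suc m) then show ?thesis using n(2)[of m] by (simp add: h_def)
    qed
    define D where "D = A * y ^ n / (1 - y)"
    have cell: "\<bar>b u - b (real i * h)\<bar> \<le> D"
      if "i < 2 ^ n" "real i * h \<le> u" "u \<le> real (Suc i) * h" for i u
    proof -
      have "summable (\<lambda>j. A * y ^ n * y ^ j)" using y by (intro summable_mult summable_geometric) simp
      \<comment> \<open>Level j of the refinement of a grid with \<open>2 ^ n\<close> cells is level
        \<open>n + j\<close> of the original dyadic grid, which pulls out the factor
        \<open>y ^ n\<close>.\<close>
      moreover have "\<bar>b (real (Suc i) * (T / real (2 ^ n * 2 ^ j))) - b (real i * (T / real (2 ^ n * 2 ^ j)))\<bar>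
         \<le> A * y ^ n * y ^ j" if "i < 2 ^ n * 2 ^ j" for i j
        using inc[of i "n + j"] that by (simp add: power_add y_def mult.assoc)
      ultimately have "\<bar>b u - b (real i * (T / real (2 ^ n)))\<bar> \<le> (\<Sum>j. A * y ^ n * y ^ j)"
        using that by (intro dyadic_chaining[OF \<open>T > 0\<close> _ cont]) (simp_all add: h_def)
      also have "\<dots> = D" using y by (subst suminf_mult) (auto simp: suminf_geometric D_def)
      finally show ?thesis by (simp add: h_def)
    qed
    define i where "i = nat \<lfloor>s / h\<rfloor>"
    have "real i \<le> s / h" "s / h < real i + 1"
      using st hpos by (auto simp: i_def)
    then have ih: "real i * h \<le> s" "s < real (Suc i) * h" using hpos by (auto simp: field_simps)
    have lt: "i' < 2 ^ n" if "real i' * h < T" for i'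
    proof -
      have "real i' * h < real (2 ^ n) * h" using that by (simp add: h_def)
      then show ?thesis using hpos by (simp only: mult_less_cancel_right of_nat_less_iff)
    qed
    have i: "i < 2 ^ n" using ih st by (intro lt) simp
    have cs: "\<bar>b s - b (real i * h)\<bar> \<le> D" using cell[OF i] ih by simp
    have D0: "D \<ge> 0" using cs by linarith
    have "\<bar>b t - b s\<bar> \<le> 3 * D"
    proof (cases "t \<le> real (Suc i) * h")
      case True
      then have "\<bar>b t - b (real i * h)\<bar> \<le> D" using cell[OF i, of t] ih st by simp
      then show ?thesis using cs D0 by linarith
    next
      case False
      then have "Suc i < 2 ^ n" using st by (intro lt) simp
      moreover have "t \<le> real (Suc (Suc i)) * h" using ih tsh by (simp add: algebra_simps)
      ultimately have "\<bar>b t - b (real (Suc i) * h)\<bar> \<le> D" using cell[of "Suc i" t] False by simp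
      moreover have "\<bar>b (real (Suc i) * h) - b (real i * h)\<bar> \<le> D"
        using cell[OF i, of "real (Suc i) * h"] hpos by simp
      ultimately show ?thesis using cs by linarith
    qed
    also have "3 * D \<le> 6 * A / (1 - y) * T powr -\<gamma> * (t - s) powr \<gamma>"
    proof -
      have "y ^ n = (1 / 2 ^ n) powr \<gamma>"
        by (simp add: y_def powr_minus powr_divide powr_realpow[symmetric] powr_powr powr_power inverse_eq_divide mult.commute)
      also have "\<dots> \<le> (2 * ((t - s) / T)) powr \<gamma>"
        using n(1) \<open>T > 0\<close> \<gamma> by (intro powr_mono2) (auto simp: field_simps)
      also have "\<dots> = 2 powr \<gamma> * ((t - s) powr \<gamma> * T powr -\<gamma>)"
      proof -
        have "((t - s) / T) powr \<gamma> = (t - s) powr \<gamma> * T powr -\<gamma>"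
          using st \<open>T > 0\<close> by (simp add: powr_divide powr_minus_divide)
        then show ?thesis using powr_mult[of 2 "(t - s) / T" \<gamma>] st \<open>T > 0\<close> by simp
      qed
      also have "\<dots> \<le> 2 * ((t - s) powr \<gamma> * T powr -\<gamma>)"
        using \<gamma> powr_mono[of \<gamma> 1 2] by (intro mult_right_mono) auto
      finally have "3 * A / (1 - y) * y ^ n \<le> 3 * A / (1 - y) * (2 * ((t - s) powr \<gamma> * T powr -\<gamma>))"
        using y \<open>A \<ge> 0\<close> by (intro mult_left_mono) auto
      then show ?thesis by (simp add: D_def algebra_simps)
    qed
    finally show ?thesis .
  qed
  show ?thesis
  proof (cases s t rule: linorder_cases)
    case less then show ?thesis using main[of s t] st by (simp add: y_def)
  next
    case equal then show ?thesis using \<gamma> by simp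
  next
    case greater then show ?thesis using main[of t s] st by (simp add: y_def abs_minus_commute)
  qed
qed

text \<open>Inverting the exponential leaves the logarithm of the weight
  \<open>N * 4 ^ j * g\<close> under a square root. The number of cells thus enters only as
  \<open>ln N\<close>, and the level only as \<open>2 * j\<close> because
  \<open>ln 4 \<le> 2\<close>.\<close>

lemma dyadic_exp_bound_increment:
  assumes b: "dyadic_exp_bound T H N b g" and "T > 0" "N > 0" "g \<ge> 1" and i: "i < N * 2 ^ j"
  shows "\<bar>b (real (Suc i) * (T / real (N * 2 ^ j))) - b (real i * (T / real (N * 2 ^ j)))\<bar>
    \<le> 2 * (T / real N) powr H * (2 powr -H) ^ j * sqrt (ln (real N) + 2 * real j + ln g)"
proof -
  define h where "h = T / real (N * 2 ^ j)"
  define x where "x = b (real (Suc i) * h) - b (real i * h)"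
  have hpos: "h > 0" using assms by (simp add: h_def)
  have "exp (x\<^sup>2 / (4 * h powr (2 * H))) \<le> real N * 4 ^ j * g"
    using b i unfolding dyadic_exp_bound_def x_def h_def by blast
  then have "x\<^sup>2 / (4 * h powr (2 * H)) \<le> ln (real N * 4 ^ j * g)"
    using assms by (subst ln_ge_iff) (auto intro!: mult_pos_pos)
  also have "\<dots> = ln (real N) + real j * ln 4 + ln g"
    using assms by (simp add: ln_mult ln_realpow)
  also have "\<dots> \<le> ln (real N) + 2 * real j + ln g"
  proof -
    have "ln (4::real) = 2 * ln 2" using ln_realpow[of 2 2] by simp
    also have "\<dots> \<le> 2" using ln_2_less_1 by simp
    finally show ?thesis using mult_left_mono[of "ln 4" 2 "real j"] by simp
  qed
  finally have "x\<^sup>2 \<le> 4 * h powr (2 * H) * (ln (real N) + 2 * real j + ln g)"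
    using hpos by (simp add: field_simps)
  then have "\<bar>x\<bar> \<le> sqrt (4 * h powr (2 * H) * (ln (real N) + 2 * real j + ln g))"
    using real_sqrt_le_mono[of "x\<^sup>2"] by simp
  also have "\<dots> = 2 * h powr H * sqrt (ln (real N) + 2 * real j + ln g)"
  proof -
    have "4 * h powr (2 * H) = (2 * h powr H)\<^sup>2" by (simp add: power_mult_distrib power2_eq_square powr_add[symmetric])
    then show ?thesis by (simp add: real_sqrt_mult)
  qed
  also have "h powr H = (T / real N) powr H * (2 powr -H) ^ j"
  proof -
    have "h = T / real N * (1 / 2 ^ j)" by (simp add: h_def)
    then have "h powr H = (T / real N) powr H * (1 / 2 ^ j) powr H"
      using assms by (simp only: powr_mult)
    also have "(1 / 2 ^ j) powr H = (2 powr -H) ^ j"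
      by (simp add: powr_minus powr_divide powr_realpow[symmetric] powr_powr powr_power inverse_eq_divide mult.commute)
    finally show ?thesis .
  qed
  finally show ?thesis by (simp add: x_def h_def mult.assoc)
qed

lemma Suc_power_sums:
  fixes q :: real assumes "0 \<le> q" "q < 1"
  shows "(\<lambda>j. (1 + real j) * q ^ j) sums (1 / (1 - q)\<^sup>2)"
  using geometric_deriv_sums[of q] assms by simp

text \<open>Keeps \<open>sqrt (ln N)\<close> away from 0, so that terms without a logarithm can be
  absorbed into it; at \<open>N = 1\<close> this factor would vanish.\<close>

lemma half_le_ln:
  assumes "N \<ge> (2::nat)" shows "1 / 2 \<le> ln (real N)"
proof -
  have "1 / 2 \<le> ln (2::real)" using ln_le_minus_one[of "1 / 2 :: real"] by (simp add: ln_div)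
  also have "\<dots> \<le> ln (real N)" using assms by simp
  finally show ?thesis .
qed

text \<open>The square root of the sum \<open>ln N + 2 * j + ln g\<close> is replaced by a product,
  \<open>sqrt (ln N)\<close> times \<open>2 * (1 + j) * (1 + ln g)\<close>. This separates the rate,
  the level and the randomness, and the sum over the levels becomes the arithmetic-geometric series
  of \<open>Suc_power_sums\<close>.\<close>

lemma dyadic_exp_bound_cell_oscillation:
  assumes b: "dyadic_exp_bound T H N b g" and "T > 0" "H > 0" "N \<ge> 2" "g \<ge> 1"
    and cont: "continuous_on {0..T} b" and i: "i < N"
    and s: "real i * (T / real N) \<le> s" "s \<le> real (Suc i) * (T / real N)"
  shows "\<bar>b s - b (real i * (T / real N))\<bar>
    \<le> 4 / (1 - 2 powr -H)\<^sup>2 * ((T / real N) powr H * sqrt (ln (real N))) * (1 + ln g)"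
proof -
  define q where "q = 2 powr -H"
  have q: "0 < q" "q < 1" using \<open>H > 0\<close> by (auto simp: q_def powr_minus inverse_less_1_iff)
  define c where "c = 4 * ((T / real N) powr H * sqrt (ln (real N))) * (1 + ln g)"
  have sums: "(\<lambda>j. c * ((1 + real j) * q ^ j)) sums (c * (1 / (1 - q)\<^sup>2))"
    using q by (intro sums_mult Suc_power_sums) auto
  have "\<bar>b s - b (real i * (T / real N))\<bar> \<le> (\<Sum>j. c * ((1 + real j) * q ^ j))"
  proof (rule dyadic_chaining[OF \<open>T > 0\<close> _ cont _ _ i s])
    show "N > 0" using \<open>N \<ge> 2\<close> by simp
    show "summable (\<lambda>j. c * ((1 + real j) * q ^ j))" using sums by (rule sums_summable)
    fix j i assume "i < N * 2 ^ j"
    then have "\<bar>b (real (Suc i) * (T / real (N * 2 ^ j))) - b (real i * (T / real (N * 2 ^ j)))\<bar>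
      \<le> 2 * (T / real N) powr H * q ^ j * sqrt (ln (real N) + 2 * real j + ln g)"
      unfolding q_def using assms by (intro dyadic_exp_bound_increment[OF b]) auto
    moreover have "sqrt (ln (real N) + 2 * real j + ln g) \<le> sqrt (ln (real N)) * (2 * ((1 + real j) * (1 + ln g)))"
    proof -
      define u v where "u = real j" and "v = ln g"
      have uv: "u \<ge> 0" "v \<ge> 0" using \<open>g \<ge> 1\<close> by (auto simp: u_def v_def)
      have l2: "ln (real N) \<ge> 1 / 2" using \<open>N \<ge> 2\<close> by (rule half_le_ln)
      have "ln (real N) + 2 * u + v \<le> ln (real N) * (1 + 4 * u + 2 * v)"
        using mult_right_mono[OF l2, of "4 * u + 2 * v"] uv by (simp add: algebra_simps)
      also have "\<dots> \<le> ln (real N) * (2 * ((1 + u) * (1 + v)))\<^sup>2"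
      proof (rule mult_left_mono)
        have e: "(2 * ((1 + u) * (1 + v)))\<^sup>2 = 4 * (1 + u)\<^sup>2 * (1 + v)\<^sup>2" by (simp add: power_mult_distrib)
        have "1 + 4 * u + 2 * v \<le> 4 * ((1 + u) * (1 + v))" using uv by (simp add: algebra_simps)
        also have "(1 + u) * (1 + v) \<le> (1 + u)\<^sup>2 * (1 + v)\<^sup>2"
          using uv by (intro mult_mono) (auto simp: power2_eq_square)
        finally show "1 + 4 * u + 2 * v \<le> (2 * ((1 + u) * (1 + v)))\<^sup>2" using e by simp
      qed (use l2 in simp)
      finally have "sqrt (ln (real N) + 2 * u + v) \<le> sqrt (ln (real N) * (2 * ((1 + u) * (1 + v)))\<^sup>2)"
        by simp
      also have "\<dots> = sqrt (ln (real N)) * (2 * ((1 + u) * (1 + v)))"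
        using uv by (simp add: real_sqrt_mult)
      finally show ?thesis by (simp add: u_def v_def)
    qed
    ultimately have "\<bar>b (real (Suc i) * (T / real (N * 2 ^ j))) - b (real i * (T / real (N * 2 ^ j)))\<bar>
      \<le> 2 * (T / real N) powr H * q ^ j * (sqrt (ln (real N)) * (2 * ((1 + real j) * (1 + ln g))))"
      using q by (elim order_trans, intro mult_left_mono) auto
    also have "\<dots> = c * ((1 + real j) * q ^ j)" by (simp only: c_def mult_ac)
    finally show "\<bar>b (real (Suc i) * (T / real (N * 2 ^ j))) - b (real i * (T / real (N * 2 ^ j)))\<bar>
      \<le> c * ((1 + real j) * q ^ j)" .
  qed
  also have "\<dots> = c * (1 / (1 - q)\<^sup>2)" using sums by (rule sums_unique[symmetric])
  finally show ?thesis by (simp add: c_def q_def)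
qed

text \<open>Splitting H as \<gamma> plus \<open>H - \<gamma>\<close> splits the decay per level:
  \<open>2 powr -\<gamma>\<close> remains as the Hoelder decay, while the powers of
  \<open>z = 2 powr -(H - \<gamma>)\<close> absorb the factor \<open>1 + j\<close>, a single term of
  the series being at most its sum. This is why \<gamma> has to stay strictly below H.\<close>

lemma dyadic_exp_bound_holder:
  assumes b: "dyadic_exp_bound T H 1 b g" and "T > 0" "g \<ge> 1" "0 < \<gamma>" "\<gamma> < H" "\<gamma> \<le> 1"
    and cont: "continuous_on {0..T} b" and st: "s \<in> {0..T}" "t \<in> {0..T}"
  shows "\<bar>b t - b s\<bar> \<le> 6 * (4 * T powr H * (1 / (1 - 2 powr -(H - \<gamma>))\<^sup>2) * (1 + ln g)) / (1 - 2 powr -\<gamma>)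
    * T powr -\<gamma> * \<bar>t - s\<bar> powr \<gamma>"
proof -
  define z where "z = 2 powr -(H - \<gamma>)"
  have z: "0 < z" "z < 1" using assms by (auto simp: z_def powr_less_one)
  define A where "A = 4 * T powr H * (1 / (1 - z)\<^sup>2) * (1 + ln g)"
  have l: "ln g \<ge> 0" using \<open>g \<ge> 1\<close> by simp
  have "\<bar>b t - b s\<bar> \<le> 6 * A / (1 - 2 powr -\<gamma>) * T powr -\<gamma> * \<bar>t - s\<bar> powr \<gamma>"
  proof (rule dyadic_holder)
    show "A \<ge> 0" using l by (simp add: A_def)
    fix j i :: nat assume i: "i < 2 ^ j"
    have "\<bar>b (real (Suc i) * (T / 2 ^ j)) - b (real i * (T / 2 ^ j))\<bar>
      \<le> 2 * T powr H * (2 powr -H) ^ j * sqrt (2 * real j + ln g)"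
      using dyadic_exp_bound_increment[OF b, of i j] assms i by simp
    moreover have "sqrt (2 * real j + ln g) \<le> 2 * ((1 + real j) * (1 + ln g))"
    proof (rule real_le_lsqrt)
      define u v where "u = real j" and "v = ln g"
      have uv: "u \<ge> 0" "v \<ge> 0" using l by (auto simp: u_def v_def)
      have e: "(2 * ((1 + u) * (1 + v)))\<^sup>2 = 4 * (1 + u)\<^sup>2 * (1 + v)\<^sup>2" by (simp add: power_mult_distrib)
      have "2 * u + v \<le> 4 * ((1 + u) * (1 + v))" using uv by (simp add: algebra_simps)
      also have "(1 + u) * (1 + v) \<le> (1 + u)\<^sup>2 * (1 + v)\<^sup>2"
        using uv by (intro mult_mono) (auto simp: power2_eq_square)
      finally show "2 * real j + ln g \<le> (2 * ((1 + real j) * (1 + ln g)))\<^sup>2"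
        using e by (simp add: u_def v_def)
    qed (use l in simp)
    ultimately have "\<bar>b (real (Suc i) * (T / 2 ^ j)) - b (real i * (T / 2 ^ j))\<bar>
      \<le> 2 * T powr H * (2 powr -H) ^ j * (2 * ((1 + real j) * (1 + ln g)))"
      by (elim order_trans, intro mult_left_mono) auto
    also have "2 * T powr H * (2 powr -H) ^ j * (2 * ((1 + real j) * (1 + ln g)))
      = 4 * T powr H * (1 + ln g) * (2 powr -\<gamma>) ^ j * ((1 + real j) * z ^ j)"
    proof -
      have "2 powr -H = 2 powr -\<gamma> * z" by (simp add: z_def powr_add[symmetric])
      then show ?thesis by (simp add: power_mult_distrib)
    qed
    also have "\<dots> \<le> 4 * T powr H * (1 + ln g) * (2 powr -\<gamma>) ^ j * (1 / (1 - z)\<^sup>2)"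
    proof -
      have "(1 + real j) * z ^ j \<le> (\<Sum>j. (1 + real j) * z ^ j)"
        using sum_le_suminf[of "\<lambda>j. (1 + real j) * z ^ j" "{j}"] sums_summable[OF Suc_power_sums[of z]] z
        by simp
      then have "(1 + real j) * z ^ j \<le> 1 / (1 - z)\<^sup>2" using sums_unique[OF Suc_power_sums[of z]] z by simp
      then show ?thesis using l by (intro mult_left_mono) auto
    qed
    finally show "\<bar>b (real (Suc i) * (T / 2 ^ j)) - b (real i * (T / 2 ^ j))\<bar> \<le> A * (2 powr -\<gamma>) ^ j"
      by (simp only: A_def mult_ac)
  qed (use assms in auto)
  then show ?thesis by (simp only: A_def z_def)
qed

text \<open>Applying \<open>ln u \<le> u - 1\<close> to \<open>u = g powr (1 / e)\<close> rather
  than to g makes the e-th power linear in g. The first moment of the functional thereby controls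
  every power of \<open>1 + ln G\<close>.\<close>

lemma one_plus_ln_powr_le:
  fixes e g :: real assumes "e > 0" "g \<ge> 1"
  shows "(1 + ln g) powr e \<le> (1 + e) powr e * g"
proof -
  have "ln g = e * ln (g powr (1 / e))" using assms by (simp add: ln_powr)
  also have "\<dots> \<le> e * (g powr (1 / e) - 1)"
    using assms by (intro mult_left_mono ln_le_minus_one) auto
  finally have "1 + ln g \<le> (1 + e) * g powr (1 / e)"
    using assms ge_one_powr_ge_zero[of g "1 / e"] by (simp add: algebra_simps)
  then have "(1 + ln g) powr e \<le> ((1 + e) * g powr (1 / e)) powr e"
    using assms by (intro powr_mono2) auto
  also have "\<dots> = (1 + e) powr e * g" using assms by (simp add: powr_mult powr_powr)
  finally show ?thesis .
qed

section \<open>Paths of the singular equation\<close>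

text \<open>Here a, k and w stand for \<open>\<kappa> * \<theta> / 2\<close>,
  \<open>\<kappa> / 2\<close> and \<open>\<sigma> / 2\<close> times the noise path; k may have
  either sign. The equation is stated for increments because it is restarted later, at the last
  visit to a level and at grid points.\<close>

locale singular_drift_path =
  fixes a k T X0 :: real and x w :: "real \<Rightarrow> real"
  assumes a: "a > 0" and T: "T > 0" and X0: "X0 > 0"
    and cont: "continuous_on {0..T} x" and pos: "\<And>t. t \<in> {0..T} \<Longrightarrow> x t > 0"
    and start: "x 0 = X0"
    and eq: "\<And>s t. 0 \<le> s \<Longrightarrow> s \<le> t \<Longrightarrow> t \<le> T \<Longrightarrow>
      x t - x s = integral {s..t} (\<lambda>r. a / x r - k * x r) + (w t - w s)"
begin

lemma continuous_on_x: "0 \<le> s \<Longrightarrow> t \<le> T \<Longrightarrow> continuous_on {s..t} x"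
  using cont by (rule continuous_on_subset) auto

lemma continuous_on_drift:
  "0 \<le> s \<Longrightarrow> t \<le> T \<Longrightarrow> continuous_on {s..t} (\<lambda>r. a / x r - k * x r)"
  using pos by (intro continuous_intros continuous_on_x) (force simp: less_le)+

lemma drift_integrable:
  "0 \<le> s \<Longrightarrow> t \<le> T \<Longrightarrow> (\<lambda>r. a / x r - k * x r) integrable_on {s..t}"
  by (intro integrable_continuous_interval continuous_on_drift)

text \<open>Let \<open>m = x \<tau>\<close> be the minimum, attained after \<open>\<rho>\<close>, the last time where \<open>x = 2 * m\<close>. On
  \<open>{\<rho>..\<tau>}\<close>, of length \<open>\<delta>\<close>, the drift is at least \<open>a / (4 * m)\<close>, so the noise must fall by
  \<open>m + a * \<delta> / (4 * m)\<close>, which exceeds \<open>m powr (1 - \<gamma>) * (a * \<delta> / (4 * m)) powr \<gamma>\<close>; comparing with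
  \<open>K * \<delta> powr \<gamma>\<close> cancels \<open>\<delta>\<close> and, as \<open>\<gamma> > 1/2\<close>, bounds \<open>m\<close> from below.\<close>
lemma inverse_bound:
  assumes \<gamma>: "1 / 2 < \<gamma>" "\<gamma> \<le> 1" and K: "K \<ge> 0"
    and holder: "\<And>s t. s \<in> {0..T} \<Longrightarrow> t \<in> {0..T} \<Longrightarrow> \<bar>w t - w s\<bar> \<le> K * \<bar>t - s\<bar> powr \<gamma>"
    and r0: "r0 > 0" "2 * r0 \<le> X0" "8 * \<bar>k\<bar> * r0\<^sup>2 \<le> a" and t: "t \<in> {0..T}"
  shows "1 / x t \<le> 1 / r0 + (K / (a / 4) powr \<gamma>) powr (1 / (2 * \<gamma> - 1))"
proof -
  obtain \<tau> where \<tau>: "\<tau> \<in> {0..T}" "\<And>t. t \<in> {0..T} \<Longrightarrow> x \<tau> \<le> x t"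
    using continuous_attains_inf[OF _ _ cont] T by (auto simp: Ball_def)
  define m where "m = x \<tau>"
  have m: "m > 0" using pos \<tau> by (simp add: m_def)
  have "1 / m \<le> 1 / r0 + (K / (a / 4) powr \<gamma>) powr (1 / (2 * \<gamma> - 1))"
  proof (cases "m \<ge> r0")
    case True
    then have "1 / m \<le> 1 / r0" using r0 by (intro divide_left_mono) auto
    then show ?thesis by (smt (verit) powr_ge_zero)
  next
    case False
    define S where "S = {t \<in> {0..\<tau>}. x t = 2 * m}"
    have c\<tau>: "continuous_on {0..\<tau>} x" using \<tau> by (intro continuous_on_x) auto
    have ivt: "\<exists>u\<in>{v..\<tau>}. x u = 2 * m" if "0 \<le> v" "v \<le> \<tau>" "x v \<ge> 2 * m" for v
      using IVT2'[of x \<tau> "2 * m" v] that m continuous_on_subset[OF c\<tau>, of "{v..\<tau>}"] by (auto simp: m_def)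
    have "S \<noteq> {}" using ivt[of 0] \<tau> start r0 False by (force simp: S_def)
    moreover have "compact S"
    proof -
      have "closed S"
        unfolding S_def using continuous_closed_preimage_constant[OF c\<tau> closed_atLeastAtMost, of "2 * m"] .
      moreover have "bounded S" by (rule bounded_subset[of "{0..\<tau>}"]) (auto simp: S_def)
      ultimately show ?thesis by (simp add: compact_eq_bounded_closed)
    qed
    ultimately obtain \<rho> where \<rho>: "\<rho> \<in> S" "\<And>t. t \<in> S \<Longrightarrow> t \<le> \<rho>"
      using compact_attains_sup[of S] by blast
    have \<rho>': "0 \<le> \<rho>" "\<rho> \<le> \<tau>" "x \<rho> = 2 * m" using \<rho>(1) by (auto simp: S_def)
    \<comment> \<open>A value above \<open>2 * m\<close> would force the path to cross that level
      again before \<tau>, against the choice of \<rho> as the last such time.\<close>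
    have below: "x t \<le> 2 * m" if tt: "t \<in> {\<rho>..\<tau>}" for t
    proof (rule ccontr)
      assume "\<not> x t \<le> 2 * m"
      then obtain u where "u \<in> {t..\<tau>}" "x u = 2 * m" using ivt[of t] tt \<rho>' by auto
      then have "u \<le> \<rho>" using \<rho>(2)[of u] tt \<rho>' by (auto simp: S_def)
      then have "u = t" "t = \<rho>" using tt \<open>u \<in> {t..\<tau>}\<close> by auto
      then show False using \<rho>' \<open>\<not> x t \<le> 2 * m\<close> by simp
    qed
    define \<delta> where "\<delta> = \<tau> - \<rho>"
    have "\<rho> \<noteq> \<tau>" using \<rho>' m by (auto simp: m_def)
    then have \<delta>: "\<delta> > 0" using \<rho>' by (simp add: \<delta>_def)
    have "a / (4 * m) * \<delta> \<le> integral {\<rho>..\<tau>} (\<lambda>r. a / x r - k * x r)"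
    proof -
      have "integral {\<rho>..\<tau>} (\<lambda>_. a / (4 * m)) \<le> integral {\<rho>..\<tau>} (\<lambda>r. a / x r - k * x r)"
      proof (rule integral_le)
        show "(\<lambda>r. a / x r - k * x r) integrable_on {\<rho>..\<tau>}"
          using \<rho>' \<tau> by (intro drift_integrable) auto
        fix r assume r: "r \<in> {\<rho>..\<tau>}"
        have xr: "m \<le> x r" "x r \<le> 2 * m" using below[OF r] \<tau>(2)[of r] r \<rho>' \<tau>(1) by (auto simp: m_def)
        \<comment> \<open>As \<open>m < r0\<close>, the smallness of r0 lets the linear part of the
          drift consume at most half of \<open>a / (2 * m)\<close>, the least value of the singular
          part here.\<close>
        have "8 * \<bar>k\<bar> * m\<^sup>2 \<le> 8 * \<bar>k\<bar> * r0\<^sup>2" using False m by (intro mult_left_mono power_mono) auto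
        then have *: "2 * \<bar>k\<bar> * m \<le> a / (4 * m)" using r0 m by (simp add: field_simps power2_eq_square)
        have "k * x r \<le> \<bar>k\<bar> * (2 * m)" using xr m by (intro mult_mono) auto
        moreover have "a / (2 * m) \<le> a / x r" using xr m a by (intro divide_left_mono) auto
        moreover have "a / (2 * m) = 2 * (a / (4 * m))" by simp
        ultimately show "a / (4 * m) \<le> a / x r - k * x r" using * by (simp only:)
      qed (rule integrable_const_ivl)
      then show ?thesis using \<rho>' by (simp add: \<delta>_def mult.commute)
    qed
    moreover have "x \<tau> - x \<rho> = - m" using \<rho>' by (simp add: m_def)
    ultimately have "m + a / (4 * m) * \<delta> \<le> \<bar>w \<tau> - w \<rho>\<bar>" using eq[of \<rho> \<tau>] \<rho>' \<tau> by auto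
    also have "\<dots> \<le> K * \<delta> powr \<gamma>" using holder[of \<rho> \<tau>] \<rho>' \<tau> \<delta> by (simp add: \<delta>_def)
    finally have up: "m + a / (4 * m) * \<delta> \<le> K * \<delta> powr \<gamma>" .
    define v where "v = a / (4 * m) * \<delta>"
    have v: "v > 0" using a m \<delta> by (simp add: v_def)
    have "m powr (1 - \<gamma>) * v powr \<gamma> \<le> (m + v) powr (1 - \<gamma>) * (m + v) powr \<gamma>"
      using m v \<gamma> by (intro mult_mono powr_mono2) auto
    also have "\<dots> = m + v" using m v by (simp add: powr_add[symmetric])
    also have "\<dots> \<le> K * \<delta> powr \<gamma>" using up by (simp add: v_def)
    finally have "m powr (1 - \<gamma>) * v powr \<gamma> \<le> K * \<delta> powr \<gamma>" .
    \<comment> \<open>The power of \<open>1 / m\<close> collects \<gamma> from v and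
      \<open>\<gamma> - 1\<close> from the first factor. The total is positive because
      \<open>\<gamma> > 1/2\<close>, so a bound on this power bounds \<open>1 / m\<close>.\<close>
    moreover have "m powr (1 - \<gamma>) * v powr \<gamma> = (a / 4) powr \<gamma> * (1 / m) powr (2 * \<gamma> - 1) * \<delta> powr \<gamma>"
    proof -
      have "v = (a / 4) * \<delta> * (1 / m)" by (simp add: v_def)
      then have "v powr \<gamma> = (a / 4) powr \<gamma> * \<delta> powr \<gamma> * (1 / m) powr \<gamma>"
        using a m \<delta> by (simp only: powr_mult)
      moreover have "m powr (1 - \<gamma>) = (1 / m) powr (\<gamma> - 1)"
        using m by (simp add: powr_divide powr_minus_divide[symmetric])
      moreover have "(1 / m) powr (\<gamma> - 1) * (1 / m) powr \<gamma> = (1 / m) powr (2 * \<gamma> - 1)"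
        by (simp add: powr_add[symmetric])
      ultimately show ?thesis by (simp add: mult_ac)
    qed
    ultimately have "(a / 4) powr \<gamma> * (1 / m) powr (2 * \<gamma> - 1) \<le> K" using \<delta> by simp
    then have "(1 / m) powr (2 * \<gamma> - 1) \<le> K / (a / 4) powr \<gamma>" using a by (simp add: field_simps)
    then have "((1 / m) powr (2 * \<gamma> - 1)) powr (1 / (2 * \<gamma> - 1)) \<le> (K / (a / 4) powr \<gamma>) powr (1 / (2 * \<gamma> - 1))"
      using \<gamma> by (intro powr_mono2) auto
    then have "1 / m \<le> (K / (a / 4) powr \<gamma>) powr (1 / (2 * \<gamma> - 1))"
      using \<gamma> m by (simp add: powr_powr)
    then show ?thesis using r0 by (smt (verit) zero_less_divide_1_iff)
  qed
  moreover have "1 / x t \<le> 1 / m" using \<tau>(2)[OF t] m by (intro divide_left_mono) (auto simp: m_def pos t)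
  ultimately show ?thesis by linarith
qed

text \<open>A Gronwall estimate, read off at the maximum of \<open>x t * exp (- \<mu> * t)\<close>.\<close>
lemma upper_bound:
  assumes R: "\<And>t. t \<in> {0..T} \<Longrightarrow> 1 / x t \<le> R"
    and D: "\<And>t. t \<in> {0..T} \<Longrightarrow> \<bar>w t - w 0\<bar> \<le> D" and t: "t \<in> {0..T}"
  shows "x t \<le> 2 * (X0 + a * R * T + D) * exp ((2 * \<bar>k\<bar> + 1) * T)"
proof -
  \<comment> \<open>With this rate \<open>\<bar>k\<bar> / \<mu> \<le> 1 / 2\<close>, so the integral
    returns at most half of the maximum and can be absorbed on the left; this is the factor 2 in the
    bound.\<close>
  define \<mu> where "\<mu> = 2 * \<bar>k\<bar> + 1"
  have \<mu>: "\<mu> > 0" by (simp add: \<mu>_def)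
  define z where "z t = x t * exp (- \<mu> * t)" for t
  have xz: "x t = z t * exp (\<mu> * t)" for t by (simp add: z_def mult.assoc exp_add[symmetric])
  have "continuous_on {0..T} z" unfolding z_def[abs_def] by (intro continuous_intros cont)
  then obtain \<tau> where \<tau>: "\<tau> \<in> {0..T}" "\<And>t. t \<in> {0..T} \<Longrightarrow> z t \<le> z \<tau>"
    using continuous_attains_sup[of "{0..T}" z] T by (auto simp: Ball_def)
  define A where "A = X0 + a * R * T + D"
  have R0: "0 \<le> R" using R[of 0] pos[of 0] T by (smt (verit) atLeastAtMost_iff zero_less_divide_1_iff)
  have D0: "0 \<le> D" using D[of 0] T by simp
  have A0: "A \<ge> 0" using X0 R0 D0 a T by (simp add: A_def)
  have z0: "z \<tau> > 0" using pos \<tau> by (simp add: z_def)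
  have hi: "((\<lambda>r. a * R + \<bar>k\<bar> * z \<tau> * exp (\<mu> * r)) has_integral
      a * R * \<tau> + \<bar>k\<bar> * z \<tau> * exp (\<mu> * \<tau>) / \<mu> - (a * R * 0 + \<bar>k\<bar> * z \<tau> * exp (\<mu> * 0) / \<mu>)) {0..\<tau>}"
    using \<tau> \<mu> by (intro fundamental_theorem_of_calculus)
      (auto intro!: derivative_eq_intros simp flip: has_real_derivative_iff_has_vector_derivative)
  have "integral {0..\<tau>} (\<lambda>r. a / x r - k * x r) \<le> integral {0..\<tau>} (\<lambda>r. a * R + \<bar>k\<bar> * z \<tau> * exp (\<mu> * r))"
  proof (rule integral_le)
    show "(\<lambda>r. a / x r - k * x r) integrable_on {0..\<tau>}" using \<tau> by (intro drift_integrable) auto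
    show "(\<lambda>r. a * R + \<bar>k\<bar> * z \<tau> * exp (\<mu> * r)) integrable_on {0..\<tau>}" using hi by blast
    fix r assume "r \<in> {0..\<tau>}"
    then have r: "r \<in> {0..T}" using \<tau> by auto
    have "a / x r \<le> a * R" using mult_left_mono[OF R[OF r], of a] a by simp
    moreover have "- k * x r \<le> \<bar>k\<bar> * x r" using pos[OF r] by (intro mult_right_mono) auto
    moreover have "\<bar>k\<bar> * x r \<le> \<bar>k\<bar> * (z \<tau> * exp (\<mu> * r))"
      unfolding xz[of r] using \<tau>(2)[OF r] by (intro mult_left_mono mult_right_mono) auto
    ultimately show "a / x r - k * x r \<le> a * R + \<bar>k\<bar> * z \<tau> * exp (\<mu> * r)" by simp
  qed
  also have "\<dots> \<le> a * R * T + exp (\<mu> * \<tau>) * (z \<tau> / 2)"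
  proof -
    have "\<bar>k\<bar> / \<mu> \<le> 1 / 2" by (simp add: \<mu>_def field_simps)
    then have "\<bar>k\<bar> / \<mu> * (z \<tau> * exp (\<mu> * \<tau>)) \<le> 1 / 2 * (z \<tau> * exp (\<mu> * \<tau>))"
      using z0 by (intro mult_right_mono) auto
    moreover have "a * R * \<tau> \<le> a * R * T" using a R0 \<tau> by (intro mult_left_mono) auto
    moreover have "0 \<le> \<bar>k\<bar> * z \<tau> / \<mu>" using z0 \<mu> by simp
    moreover have "integral {0..\<tau>} (\<lambda>r. a * R + \<bar>k\<bar> * z \<tau> * exp (\<mu> * r))
      = a * R * \<tau> + \<bar>k\<bar> / \<mu> * (z \<tau> * exp (\<mu> * \<tau>)) - \<bar>k\<bar> * z \<tau> / \<mu>"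
      using integral_unique[OF hi] by simp
    ultimately show ?thesis by (simp add: mult.commute)
  qed
  finally have "x \<tau> \<le> A + exp (\<mu> * \<tau>) * (z \<tau> / 2)"
    using eq[of 0 \<tau>] \<tau>(1) start D[OF \<tau>(1)] by (simp add: A_def)
  moreover have "A \<le> A * exp (\<mu> * \<tau>)" using A0 \<mu> \<tau>(1) mult_left_mono[of 1 "exp (\<mu> * \<tau>)" A] by simp
  ultimately have "z \<tau> * exp (\<mu> * \<tau>) \<le> (A + z \<tau> / 2) * exp (\<mu> * \<tau>)"
    unfolding xz[of \<tau>] by (simp add: algebra_simps)
  then have zA: "z \<tau> \<le> 2 * A" by simp
  have "x t = z t * exp (\<mu> * t)" by (rule xz)
  also have "\<dots> \<le> 2 * A * exp (\<mu> * T)"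
    using order_trans[OF \<tau>(2)[OF t] zA] A0 t \<mu> by (intro mult_mono) auto
  finally show ?thesis by (simp add: A_def \<mu>_def)
qed

lemma increment_bound:
  assumes F: "\<And>r. r \<in> {0..T} \<Longrightarrow> \<bar>a / x r - k * x r\<bar> \<le> F"
    and st: "0 \<le> s" "s \<le> t" "t \<le> T"
  shows "\<bar>x t - x s\<bar> \<le> F * (t - s) + \<bar>w t - w s\<bar>"
proof -
  have "norm (integral {s..t} (\<lambda>r. a / x r - k * x r)) \<le> F * (t - s)"
    using st F by (intro integral_bound continuous_on_drift) auto
  then show ?thesis using eq[OF st] by simp
qed

lemma drift_lipschitz:
  assumes "0 < u" "0 < v" "1 / u \<le> R" "1 / v \<le> R"
  shows "\<bar>(a / u - k * u) - (a / v - k * v)\<bar> \<le> (a * R\<^sup>2 + \<bar>k\<bar>) * \<bar>u - v\<bar>"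
proof -
  have "(a / u - k * u) - (a / v - k * v) = - (a * (1 / u * (1 / v)) + k) * (u - v)"
    using assms by (simp add: field_simps)
  then have "\<bar>(a / u - k * u) - (a / v - k * v)\<bar> = \<bar>a * (1 / u * (1 / v)) + k\<bar> * \<bar>u - v\<bar>"
    by (simp only: abs_mult abs_minus_cancel)
  also have "\<dots> \<le> (a * R\<^sup>2 + \<bar>k\<bar>) * \<bar>u - v\<bar>"
  proof (rule mult_right_mono)
    have "1 / u * (1 / v) \<le> R * R" using assms by (intro mult_mono) (auto intro: order_trans[rotated])
    then have "a * (1 / u * (1 / v)) \<le> a * R\<^sup>2" using a by (intro mult_left_mono) (auto simp: power2_eq_square)
    moreover have "0 \<le> a * (1 / u * (1 / v))" using a assms by simp
    ultimately show "\<bar>a * (1 / u * (1 / v)) + k\<bar> \<le> a * R\<^sup>2 + \<bar>k\<bar>" by linarith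
  qed simp
  finally show ?thesis .
qed

end

section \<open>The backward Euler scheme\<close>

text \<open>A case split suffices in place of an induction: one step returns a positive value from
  any real y, since the square root strictly exceeds \<open>\<bar>y\<bar>\<close>.\<close>

lemma backward_euler_pos:
  assumes "X0 > 0" "\<kappa> * \<theta> > 0" "h > 0" "2 + \<kappa> * h > 0"
  shows "backward_euler \<kappa> \<theta> \<sigma> X0 h b n > 0"
proof (cases n)
  case (Suc m)
  define y where "y = backward_euler \<kappa> \<theta> \<sigma> X0 h b m + 1/2 * \<sigma> * (b (real (Suc m) * h) - b (real m * h))"
  define q where "q = \<kappa> * h * \<theta> * (2 + \<kappa> * h)"
  have "q = \<kappa> * \<theta> * h * (2 + \<kappa> * h)" by (simp add: q_def)
  then have "q > 0" using assms by simp
  then have "sqrt (y\<^sup>2) < sqrt (y\<^sup>2 + q)" by (intro real_sqrt_less_mono) simp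
  then have "y + sqrt (y\<^sup>2 + q) > 0" by simp
  then show ?thesis using assms Suc by (simp add: Let_def y_def q_def)
qed (use assms in simp)

text \<open>Multiplied by \<open>2 * z\<close>, the implicit relation is the quadratic equation
  \<open>c * z\<^sup>2 - 2 * y * z = \<kappa> * h * \<theta>\<close> with
  \<open>c = 2 + \<kappa> * h\<close>, and the scheme takes its positive root. Dividing back is
  allowed since c and z are positive.\<close>

lemma backward_euler_implicit:
  fixes \<kappa> \<theta> \<sigma> X0 h :: real and b :: "real \<Rightarrow> real"
  assumes "X0 > 0" "\<kappa> * \<theta> > 0" "h > 0" "2 + \<kappa> * h > 0"
  defines "Y \<equiv> backward_euler \<kappa> \<theta> \<sigma> X0 h b"
  shows "Y (Suc n) = Y n + h * (\<kappa> * \<theta> / 2 / Y (Suc n) - \<kappa> / 2 * Y (Suc n))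
    + \<sigma> / 2 * (b (real (Suc n) * h) - b (real n * h))"
proof -
  define y where "y = Y n + 1/2 * \<sigma> * (b (real (Suc n) * h) - b (real n * h))"
  define q where "q = \<kappa> * h * \<theta> * (2 + \<kappa> * h)"
  define c where "c = 2 + \<kappa> * h"
  define z where "z = Y (Suc n)"
  have c: "c > 0" using assms by (simp add: c_def)
  have "q = \<kappa> * \<theta> * h * (2 + \<kappa> * h)" by (simp add: q_def)
  then have "q > 0" using assms by simp
  then have "y\<^sup>2 + q \<ge> 0" by (intro add_nonneg_nonneg) auto
  then have s: "(sqrt (y\<^sup>2 + q))\<^sup>2 = y\<^sup>2 + q" by simp
  have z: "z > 0" unfolding z_def Y_def using assms by (intro backward_euler_pos) auto
  have "c * z = y + sqrt (y\<^sup>2 + q)"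
    using c by (simp add: z_def Y_def y_def q_def c_def Let_def)
  then have "(c * z - y)\<^sup>2 = y\<^sup>2 + q" using s by simp
  moreover have "(c * z - y)\<^sup>2 = c * (c * z\<^sup>2 - 2 * y * z) + y\<^sup>2"
    by (simp add: power2_eq_square algebra_simps)
  moreover have "q = c * (\<kappa> * h * \<theta>)" by (simp add: q_def c_def)
  ultimately have "c * (c * z\<^sup>2 - 2 * y * z) = c * (\<kappa> * h * \<theta>)" by linarith
  then have "c * z\<^sup>2 - 2 * y * z = \<kappa> * h * \<theta>" using c by (auto dest: mult_left_cancel[THEN iffD1, rotated])
  moreover define u where "u = \<kappa> * \<theta> / 2 / z"
  moreover have "2 * z * (z - y - h * (u - \<kappa> / 2 * z)) = c * z\<^sup>2 - 2 * y * z - 2 * h * (u * z)"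
    by (simp add: c_def power2_eq_square algebra_simps)
  moreover have "2 * h * (u * z) = \<kappa> * h * \<theta>" using z by (simp add: u_def)
  ultimately have "2 * z * (z - y - h * (u - \<kappa> / 2 * z)) = 0" by linarith
  then have "z = y + h * (\<kappa> * \<theta> / 2 / z - \<kappa> / 2 * z)" using z by (simp add: u_def)
  then show ?thesis by (simp add: z_def y_def)
qed

text \<open>Subtracting the implicit scheme from the integral equation leaves
  \<open>e (n + 1) * (1 + h * (k + a / (x * y))) = e n + residual\<close>, where \<open>a / (x * y) > 0\<close> only helps.\<close>
lemma (in singular_drift_path) backward_euler_error:
  fixes \<kappa> \<theta> \<sigma> \<xi> h R Osc :: real and b :: "real \<Rightarrow> real" and N :: nat
  assumes ak: "a = \<kappa> * \<theta> / 2" "k = \<kappa> / 2" and w: "\<And>t. w t = \<sigma> / 2 * b t"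
    and N: "N > 0" and h: "h = T / real N" "h * max 0 (- k) < 1 - \<xi>" and \<xi>: "\<xi> > 0"
    and R: "\<And>t. t \<in> {0..T} \<Longrightarrow> 1 / x t \<le> R"
    and osc: "\<And>i s. i < N \<Longrightarrow> s \<in> {real i * h..real (Suc i) * h} \<Longrightarrow> \<bar>x s - x (real (Suc i) * h)\<bar> \<le> Osc"
    and n: "n \<le> N"
  shows "\<bar>x (real n * h) - backward_euler \<kappa> \<theta> \<sigma> X0 h b n\<bar>
    \<le> exp (T * max 0 (- k) / \<xi>) * T * ((a * R\<^sup>2 + \<bar>k\<bar>) * Osc)"
proof -
  define Y where "Y = backward_euler \<kappa> \<theta> \<sigma> X0 h b"
  define L where "L = (a * R\<^sup>2 + \<bar>k\<bar>) * Osc"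
  define E where "E = exp (h * max 0 (- k) / \<xi>)"
  define f where "f u = a / u - k * u" for u
  have hpos: "h > 0" using N T h by simp
  have Nh: "real N * h = T" using N h by simp
  have Osc0: "Osc \<ge> 0" using osc[of 0 0] N hpos by (auto intro: order_trans[OF abs_ge_zero])
  have L0: "L \<ge> 0" using Osc0 a by (simp add: L_def)
  have E1: "E \<ge> 1" using hpos \<xi> by (simp add: E_def)
  have hk: "1 + h * k \<ge> 1 - h * max 0 (- k)" "1 - h * max 0 (- k) > \<xi>"
    using h(2) mult_left_mono[of "- k" "max 0 (- k)" h] hpos by auto
  \<comment> \<open>E bounds the amplification \<open>1 / (1 + h * k)\<close> of one step. For
    \<open>0 \<le> u < 1 - \<xi>\<close> one has
    \<open>1 / (1 - u) \<le> 1 + u / \<xi> \<le> exp (u / \<xi>)\<close>, and N such factors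
    multiply to a quantity free of h.\<close>
  have hkE: "1 \<le> E * (1 + h * k)"
  proof -
    define u where "u = h * max 0 (- k)"
    have u: "0 \<le> u" "1 - u > \<xi>" "1 - u \<le> 1 + h * k" using hk hpos by (auto simp: u_def)
    have "u * \<xi> \<le> u * (1 - u)" using u by (intro mult_left_mono) auto
    then have "1 \<le> (1 + u / \<xi>) * (1 - u)" using \<xi> by (simp add: field_simps)
    also have "\<dots> \<le> E * (1 + h * k)"
      using u \<xi> by (intro mult_mono) (auto simp: E_def u_def exp_ge_add_one_self)
    finally show ?thesis .
  qed
  have c: "2 + \<kappa> * h > 0" using hk \<xi> ak by (auto simp: algebra_simps)
  have \<kappa>\<theta>: "\<kappa> * \<theta> > 0" using a ak by simp
  note Ypos = backward_euler_pos[OF X0 \<kappa>\<theta> hpos c, of \<sigma> b, folded Y_def]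
  note Yimp = backward_euler_implicit[OF X0 \<kappa>\<theta> hpos c, of \<sigma> b, folded Y_def ak]
  have "\<bar>x (real n * h) - Y n\<bar> \<le> E ^ n * (real n * (h * L))"
    using n
  proof (induction n)
    case 0
    then show ?case by (simp add: Y_def start)
  next
    case (Suc n)
    define t0 t1 where "t0 = real n * h" and "t1 = real (Suc n) * h"
    have t: "0 \<le> t0" "t0 \<le> t1" "t1 \<le> T"
      using hpos Suc.prems Nh mult_right_mono[of "real (Suc n)" "real N" h] by (auto simp: t0_def t1_def)
    have th: "t1 - t0 = h" by (simp add: t0_def t1_def algebra_simps)
    have x1: "x t1 > 0" using t by (intro pos) auto
    define I where "I = integral {t0..t1} (\<lambda>r. f (x r))"
    \<comment> \<open>The implicit step evaluates the drift at the right end point, so the residual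
      is a right end point quadrature error along the exact path. Its Lipschitz constant uses the
      bound on \<open>1 / x\<close> only.\<close>
    have res: "\<bar>I - h * f (x t1)\<bar> \<le> h * L"
    proof -
      have cf: "continuous_on {t0..t1} (\<lambda>r. f (x r))" unfolding f_def using t by (intro continuous_on_drift)
      have "norm (integral {t0..t1} (\<lambda>r. f (x r) - f (x t1))) \<le> L * (t1 - t0)"
      proof (rule integral_bound)
        fix r assume r: "r \<in> {t0..t1}"
        then have rT: "r \<in> {0..T}" "t1 \<in> {0..T}" using t by auto
        have "\<bar>f (x r) - f (x t1)\<bar> \<le> (a * R\<^sup>2 + \<bar>k\<bar>) * \<bar>x r - x t1\<bar>"
          unfolding f_def using rT by (intro drift_lipschitz pos R)
        also have "\<dots> \<le> L"
          unfolding L_def using osc[of n r] Suc.prems r a by (intro mult_left_mono) (auto simp: t0_def t1_def)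
        finally show "norm (f (x r) - f (x t1)) \<le> L" by simp
      qed (use t cf in \<open>auto intro!: continuous_intros\<close>)
      moreover have "integral {t0..t1} (\<lambda>r. f (x r) - f (x t1)) = I - h * f (x t1)"
        using integrable_continuous_interval[OF cf] t th by (subst integral_diff) (auto simp: I_def)
      ultimately show ?thesis by (simp add: th mult.commute)
    qed
    define e0 e1 where "e0 = x t0 - Y n" and "e1 = x t1 - Y (Suc n)"
    define g where "g = a / (x t1 * Y (Suc n))"
    have g: "g > 0" using a x1 Ypos by (simp add: g_def)
    have "x t1 = x t0 + I + (w t1 - w t0)" using eq[OF t] by (simp add: I_def f_def)
    moreover have "Y (Suc n) = Y n + h * f (Y (Suc n)) + (w t1 - w t0)"
      using Yimp[of n] unfolding f_def t0_def t1_def w right_diff_distrib .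
    ultimately have "e1 - h * (f (x t1) - f (Y (Suc n))) = e0 + (I - h * f (x t1))"
      unfolding e0_def e1_def right_diff_distrib by linarith
    moreover have "f (x t1) - f (Y (Suc n)) = - ((g + k) * e1)"
    proof -
      have "f u - f v = - ((a / (u * v) + k) * (u - v))" if "u > 0" "v > 0" for u v
        using that by (simp add: f_def field_simps)
      then show ?thesis unfolding g_def e1_def using x1 Ypos by blast
    qed
    moreover have "(1 + h * (g + k)) * e1 = e1 - h * (- ((g + k) * e1))" by (simp add: algebra_simps)
    ultimately have "(1 + h * (g + k)) * e1 = e0 + (I - h * f (x t1))" by (simp only:)
    then have "\<bar>(1 + h * (g + k)) * e1\<bar> \<le> \<bar>e0\<bar> + h * L" using res by linarith
    moreover have "1 + h * k \<le> \<bar>1 + h * (g + k)\<bar>"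
      using mult_pos_pos[OF hpos g] by (simp only: distrib_left)
    then have "(1 + h * k) * \<bar>e1\<bar> \<le> \<bar>1 + h * (g + k)\<bar> * \<bar>e1\<bar>" by (intro mult_right_mono) auto
    ultimately have "(1 + h * k) * \<bar>e1\<bar> \<le> \<bar>e0\<bar> + h * L" by (simp only: abs_mult)
    then have "E * ((1 + h * k) * \<bar>e1\<bar>) \<le> E * (\<bar>e0\<bar> + h * L)" using E1 by (intro mult_left_mono) auto
    moreover have "1 * \<bar>e1\<bar> \<le> E * (1 + h * k) * \<bar>e1\<bar>" using hkE by (intro mult_right_mono) auto
    ultimately have "\<bar>e1\<bar> \<le> E * (\<bar>e0\<bar> + h * L)" by (simp add: mult.assoc)
    also have "\<dots> \<le> E * (E ^ n * (real n * (h * L)) + E ^ n * (h * L))"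
    proof (intro mult_left_mono add_mono)
      show "\<bar>e0\<bar> \<le> E ^ n * (real n * (h * L))" using Suc by (simp add: e0_def t0_def)
      show "h * L \<le> E ^ n * (h * L)"
        using mult_right_mono[of 1 "E ^ n" "h * L"] E1 hpos L0 by (simp add: one_le_power)
    qed (use E1 in simp)
    also have "\<dots> = E ^ Suc n * (real (Suc n) * (h * L))" by (simp add: algebra_simps)
    finally show ?case by (simp add: e1_def t1_def)
  qed
  also have "\<dots> \<le> E ^ N * (real N * (h * L))"
    using n E1 hpos L0 by (intro mult_mono power_increasing) auto
  also have "E ^ N = exp (real N * (h * max 0 (- k) / \<xi>))" unfolding E_def by (rule exp_of_nat_mult[symmetric])
  also have "real N * (h * max 0 (- k) / \<xi>) = real N * h * max 0 (- k) / \<xi>" by (simp only: times_divide_eq_right mult.assoc)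
  also have "real N * (h * L) = real N * h * L" by (simp only: mult.assoc)
  finally show ?thesis by (simp only: Y_def L_def Nh mult.assoc)
qed

text \<open>Writing the interpolation as a sum of clamped ramps avoids selecting a cell, so
  continuity in t and measurability in the nodal values can be read off the formula.\<close>

definition grid_interpolation :: "real \<Rightarrow> nat \<Rightarrow> (nat \<Rightarrow> real) \<Rightarrow> real \<Rightarrow> real" where
  "grid_interpolation h N y t = y 0 + (\<Sum>i<N. (y (Suc i) - y i) * min 1 (max 0 ((t - real i * h) / h)))"

lemma grid_interpolation_cell:
  assumes "h > 0" "n < N" and t: "real n * h \<le> t" "t \<le> real (Suc n) * h"
  shows "grid_interpolation h N y t = y n + (t - real n * h) / h * (y (Suc n) - y n)"
proof -
  let ?m = "\<lambda>i. min 1 (max 0 ((t - real i * h) / h))"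
  have m1: "?m i = 1" if "i < n" for i
  proof -
    have "real (Suc i) * h \<le> real n * h" using that \<open>h > 0\<close> by (intro mult_right_mono) auto
    then have "(t - real i * h) / h \<ge> 1" using t(1) \<open>h > 0\<close> by (simp add: field_simps)
    then show ?thesis by simp
  qed
  have m0: "?m i = 0" if "i > n" for i
  proof -
    have "real (Suc n) * h \<le> real i * h" using that \<open>h > 0\<close> by (intro mult_right_mono) auto
    then have "t \<le> real i * h" using t(2) by linarith
    then have "(t - real i * h) / h \<le> 0" using \<open>h > 0\<close> by (intro divide_nonpos_pos) auto
    then show ?thesis by simp
  qed
  have mn: "?m n = (t - real n * h) / h" using t \<open>h > 0\<close> by (auto simp: field_simps min_def max_def)
  have "(\<Sum>i<N. (y (Suc i) - y i) * ?m i) = (\<Sum>i<Suc n. (y (Suc i) - y i) * ?m i)"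
  proof (rule sum.mono_neutral_right)
    show "\<forall>i\<in>{..<N} - {..<Suc n}. (y (Suc i) - y i) * ?m i = 0"
    proof
      fix i assume "i \<in> {..<N} - {..<Suc n}"
      then have "?m i = 0" by (intro m0) auto
      then show "(y (Suc i) - y i) * ?m i = 0" by (simp only: mult_zero_right)
    qed
  qed (use \<open>n < N\<close> in auto)
  also have "\<dots> = (\<Sum>i<n. (y (Suc i) - y i) * ?m i) + (y (Suc n) - y n) * ?m n"
    by (rule sum.lessThan_Suc)
  also have "(\<Sum>i<n. (y (Suc i) - y i) * ?m i) = (\<Sum>i<n. y (Suc i) - y i)"
  proof (rule sum.cong)
    fix i assume "i \<in> {..<n}"
    then have "?m i = 1" by (intro m1) auto
    then show "(y (Suc i) - y i) * ?m i = y (Suc i) - y i" by (simp only: mult_1_right)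
  qed simp
  also have "\<dots> = y n - y 0" by (rule sum_lessThan_telescope)
  finally show ?thesis unfolding grid_interpolation_def mn by simp
qed

lemma grid_cell_exists:
  fixes h t :: real
  assumes "h > 0" "0 < t" "t \<le> real N * h"
  defines "n \<equiv> nat (\<lceil>t / h\<rceil> - 1)"
  shows "n < N" "real n * h < t" "t \<le> real (Suc n) * h"
proof -
  have c1: "\<lceil>t / h\<rceil> \<ge> 1" using assms(1,2) by (simp add: one_le_ceiling)
  then have r: "real n = of_int \<lceil>t / h\<rceil> - 1" by (simp add: n_def)
  have "real n < t / h" "t / h \<le> real (Suc n)" using r by linarith+
  then show "real n * h < t" "t \<le> real (Suc n) * h" using assms(1) by (auto simp: field_simps)
  then have "real n * h < real N * h" using assms(3) by linarith
  then show "n < N" using assms(1) by simp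
qed

lemma euler_interpolation_grid:
  assumes "h > 0" "0 \<le> t" "t \<le> real N * h"
  shows "euler_interpolation \<kappa> \<theta> \<sigma> X0 h b t = grid_interpolation h N (backward_euler \<kappa> \<theta> \<sigma> X0 h b) t"
proof (cases "t = 0")
  case True
  have "min 1 (max 0 ((0 - real i * h) / h)) = 0" for i using \<open>h > 0\<close> by simp
  then show ?thesis by (simp add: True euler_interpolation_def grid_interpolation_def)
next
  case False
  then have "t > 0" using assms by simp
  note c = grid_cell_exists[OF assms(1) this assms(3)]
  show ?thesis
    by (subst grid_interpolation_cell[OF assms(1) c(1) less_imp_le[OF c(2)] c(3)])
      (simp add: euler_interpolation_def Let_def False)
qed

text \<open>Inside a cell the error is the convex combination of \<open>x t - Y n\<close> and
  \<open>x t - Y (Suc n)\<close>, and each of these is a nodal error plus one oscillation of x.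
  Interpolation thus adds no more than the summand 1 to the constant.\<close>

lemma (in singular_drift_path) euler_interpolation_error:
  fixes \<kappa> \<theta> \<sigma> \<xi> h R Osc :: real and b :: "real \<Rightarrow> real" and N :: nat
  assumes ak: "a = \<kappa> * \<theta> / 2" "k = \<kappa> / 2" and w: "\<And>t. w t = \<sigma> / 2 * b t"
    and N: "N > 0" and h: "h = T / real N" "h * max 0 (- k) < 1 - \<xi>" and \<xi>: "\<xi> > 0"
    and R: "\<And>t. t \<in> {0..T} \<Longrightarrow> 1 / x t \<le> R"
    and osc: "\<And>i s t. i < N \<Longrightarrow> s \<in> {real i * h..real (Suc i) * h} \<Longrightarrow>
      t \<in> {real i * h..real (Suc i) * h} \<Longrightarrow> \<bar>x s - x t\<bar> \<le> Osc"
    and t: "t \<in> {0..T}"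
  shows "\<bar>x t - euler_interpolation \<kappa> \<theta> \<sigma> X0 h b t\<bar>
    \<le> (exp (T * max 0 (- k) / \<xi>) * T * (a * R\<^sup>2 + \<bar>k\<bar>) + 1) * Osc"
proof -
  define Y where "Y = backward_euler \<kappa> \<theta> \<sigma> X0 h b"
  define Err where "Err = exp (T * max 0 (- k) / \<xi>) * T * ((a * R\<^sup>2 + \<bar>k\<bar>) * Osc)"
  have hpos: "h > 0" using N T h by simp
  have Nh: "real N * h = T" using N h by simp
  have err: "\<bar>x (real n * h) - Y n\<bar> \<le> Err" if "n \<le> N" for n
    unfolding Y_def Err_def
  proof (rule backward_euler_error[OF ak w N h \<xi> R])
    show "\<bar>x s - x (real (Suc i) * h)\<bar> \<le> Osc" if "i < N" "s \<in> {real i * h..real (Suc i) * h}" for i s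
      using osc[OF that, of "real (Suc i) * h"] hpos by simp
  qed (use that in auto)
  obtain n where n: "n < N" "real n * h \<le> t" "t \<le> real (Suc n) * h"
  proof (cases "t = 0")
    case True
    then show ?thesis using that[of 0] N hpos by simp
  next
    case False
    then show ?thesis using that grid_cell_exists[OF hpos, of t N] t Nh by force
  qed
  define l where "l = (t - real n * h) / h"
  have l: "0 \<le> l" "l \<le> 1" using n hpos by (auto simp: l_def field_simps)
  define u v where "u = x t - Y n" and "v = x t - Y (Suc n)"
  have "\<bar>u\<bar> \<le> Err + Osc" using err[of n] osc[of n t "real n * h"] n hpos by (auto simp: u_def)
  moreover have "\<bar>v\<bar> \<le> Err + Osc"
    using err[of "Suc n"] osc[of n t "real (Suc n) * h"] n hpos by (auto simp: v_def)
  moreover have "\<bar>(1 - l) * u + l * v\<bar> \<le> (1 - l) * \<bar>u\<bar> + l * \<bar>v\<bar>"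
    using l by (intro order_trans[OF abs_triangle_ineq]) (simp add: abs_mult)
  ultimately have "\<bar>(1 - l) * u + l * v\<bar> \<le> (1 - l) * (Err + Osc) + l * (Err + Osc)"
    using l by (elim order_trans, intro add_mono mult_left_mono) auto
  moreover have "euler_interpolation \<kappa> \<theta> \<sigma> X0 h b t = Y n + l * (Y (Suc n) - Y n)"
    using t Nh n hpos by (simp add: euler_interpolation_grid[of h t N] grid_interpolation_cell[of h n N] Y_def l_def)
  then have "x t - euler_interpolation \<kappa> \<theta> \<sigma> X0 h b t = (1 - l) * u + l * v"
    by (simp only: u_def v_def) (simp add: algebra_simps)
  ultimately show ?thesis by (simp add: Err_def algebra_simps)
qed

section \<open>From the integral equation to a pathwise error bound with uniform constants\<close>

lemma integral_equation_singular_drift_path: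
  fixes T \<kappa> \<theta> \<sigma> X0 :: real and x b :: "real \<Rightarrow> real"
  assumes "T > 0" "X0 > 0" "\<kappa> * \<theta> > 0" "b 0 = 0"
    and cont: "continuous_on {0..T} x" and pos: "\<And>t. t \<in> {0..T} \<Longrightarrow> x t > 0"
    and eq: "\<And>t. t \<in> {0..T} \<Longrightarrow>
      x t = X0 + (LBINT s:{0..t}. 1/2 * \<kappa> * (\<theta> / x s - x s)) + 1/2 * \<sigma> * b t"
  shows "singular_drift_path (\<kappa> * \<theta> / 2) (\<kappa> / 2) T X0 x (\<lambda>t. \<sigma> / 2 * b t)"
proof
  let ?f = "\<lambda>r. \<kappa> * \<theta> / 2 / x r - \<kappa> / 2 * x r"
  have c: "continuous_on {0..t} ?f" if "t \<le> T" for t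
    using pos that continuous_on_subset[OF cont, of "{0..t}"]
    by (intro continuous_intros) (force simp: less_le)+
  have eq': "x t = X0 + integral {0..t} ?f + \<sigma> / 2 * b t" if t: "t \<in> {0..T}" for t
  proof -
    have "(\<lambda>r. 1/2 * \<kappa> * (\<theta> / x r - x r)) = ?f" by (simp add: field_simps)
    then have "(LBINT s:{0..t}. 1/2 * \<kappa> * (\<theta> / x s - x s)) = (LBINT s:{0..t}. ?f s)" by simp
    \<comment> \<open>The drift is continuous along a positive continuous path, so the Lebesgue
      integral of the equation agrees with the gauge integral of the locale.\<close>
    also have "\<dots> = integral {0..t} ?f"
      using c[of t] t by (intro set_borel_integral_eq_integral(2) borel_integrable_atLeastAtMost') auto
    finally show ?thesis using eq[OF t] by simp
  qed
  show "x 0 = X0" using eq'[of 0] assms by simp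
  fix s t assume st: "0 \<le> s" "s \<le> t" "t \<le> T"
  have "integral {0..s} ?f + integral {s..t} ?f = integral {0..t} ?f"
    using st c[of t] by (intro Henstock_Kurzweil_Integration.integral_combine integrable_continuous_interval) auto
  then show "x t - x s = integral {s..t} ?f + (\<sigma> / 2 * b t - \<sigma> / 2 * b s)"
    using eq'[of s] eq'[of t] st by simp
qed (use assms in auto)

text \<open>The constants are obtained before the path, the grid and the two functionals are chosen,
  which makes them uniform in the step size. The Lipschitz constant of the drift is quadratic in the
  bound for \<open>1 / x\<close>, and the oscillation of x adds one more factor of that size; hence
  the exponent is three times the one in \<open>inverse_bound\<close>.\<close>

lemma pathwise_euler_error:
  fixes T H \<kappa> \<theta> \<sigma> X0 \<xi> :: real
  assumes "T > 0" and H: "1/2 < H" "H < 1" and \<kappa>\<theta>: "\<kappa> * \<theta> > 0" and "\<sigma> > 0" and X0: "X0 > 0" and "0 < \<xi>"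
  obtains C r where "C \<ge> 0" "r > 0"
    "\<And>b x N h g g' t. continuous_on {0..T} b \<Longrightarrow> b 0 = 0 \<Longrightarrow> continuous_on {0..T} x \<Longrightarrow>
      (\<And>t. t \<in> {0..T} \<Longrightarrow> x t > 0) \<Longrightarrow>
      (\<And>t. t \<in> {0..T} \<Longrightarrow> x t = X0 + (LBINT s:{0..t}. 1/2 * \<kappa> * (\<theta> / x s - x s)) + 1/2 * \<sigma> * b t) \<Longrightarrow>
      dyadic_exp_bound T H 1 b g \<Longrightarrow> dyadic_exp_bound T H N b g' \<Longrightarrow> g \<ge> 1 \<Longrightarrow> g' \<ge> 1 \<Longrightarrow>
      N \<ge> 2 \<Longrightarrow> h = T / real N \<Longrightarrow> h * max 0 (- \<kappa> / 2) < 1 - \<xi> \<Longrightarrow> t \<in> {0..T} \<Longrightarrow>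
      \<bar>x t - euler_interpolation \<kappa> \<theta> \<sigma> X0 h b t\<bar>
        \<le> C * (h powr H * sqrt (ln (real N))) * ((1 + ln g) powr r * (1 + ln g'))"
proof -
  define a k where "a = \<kappa> * \<theta> / 2" and "k = \<kappa> / 2"
  \<comment> \<open>Any exponent strictly between \<open>1/2\<close> and H would serve.\<close>
  define \<gamma> where "\<gamma> = (1/2 + H) / 2"
  have \<gamma>: "1/2 < \<gamma>" "\<gamma> < H" "\<gamma> \<le> 1" using H by (auto simp: \<gamma>_def)
  then have \<gamma>0: "0 < \<gamma>" by simp
  define r where "r = 1 / (2 * \<gamma> - 1)"
  have r: "r \<ge> 1" using \<gamma> by (simp add: r_def)
  define K0 where "K0 = 6 * (4 * T powr H * (1 / (1 - 2 powr -(H - \<gamma>))\<^sup>2)) / (1 - 2 powr -\<gamma>) * T powr -\<gamma>"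
  have y: "2 powr -\<gamma> < (1::real)" using \<gamma> by (intro powr_less_one) auto
  have K0: "K0 \<ge> 0" using y by (simp add: K0_def)
  define K1 where "K1 = \<sigma> / 2 * K0"
  have K1: "K1 \<ge> 0" using K0 \<open>\<sigma> > 0\<close> by (simp add: K1_def)
  \<comment> \<open>The largest threshold shape meeting both smallness conditions of
    \<open>inverse_bound\<close>, with \<open>\<bar>k\<bar> + 1\<close> in place of
    \<open>\<bar>k\<bar>\<close> to allow \<open>k = 0\<close>.\<close>
  define r0 where "r0 = min (X0 / 2) (sqrt (a / (8 * (\<bar>k\<bar> + 1))))"
  have a: "a > 0" using \<kappa>\<theta> by (simp add: a_def)
  have r0: "r0 > 0" "2 * r0 \<le> X0" "8 * \<bar>k\<bar> * r0\<^sup>2 \<le> a"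
  proof -
    have s: "a / (8 * (\<bar>k\<bar> + 1)) > 0" using a by (intro divide_pos_pos) auto
    then show "r0 > 0" "2 * r0 \<le> X0" using X0 by (auto simp: r0_def)
    have "r0\<^sup>2 \<le> (sqrt (a / (8 * (\<bar>k\<bar> + 1))))\<^sup>2"
      using \<open>r0 > 0\<close> by (intro power_mono) (auto simp: r0_def)
    also have "\<dots> = a / (8 * (\<bar>k\<bar> + 1))" using s by simp
    finally have "8 * (\<bar>k\<bar> + 1) * r0\<^sup>2 \<le> a" by (simp add: field_simps)
    moreover have "8 * \<bar>k\<bar> * r0\<^sup>2 \<le> 8 * (\<bar>k\<bar> + 1) * r0\<^sup>2" by (intro mult_right_mono) auto
    ultimately show "8 * \<bar>k\<bar> * r0\<^sup>2 \<le> a" by linarith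
  qed
  \<comment> \<open>\<open>R1\<close>, \<open>D1\<close>, \<open>M1\<close> and \<open>F1\<close>
    bound \<open>1 / x\<close>, the noise, x and the drift relative to
    \<open>Q = (1 + ln g) powr r\<close>. As \<open>r \<ge> 1\<close>, this single power also
    dominates \<open>1 + ln g\<close> and 1.\<close>
  define R1 where "R1 = 1 / r0 + (K1 / (a / 4) powr \<gamma>) powr r"
  have R1: "R1 > 0" unfolding R1_def using r0 by (intro add_pos_nonneg) auto
  define D1 where "D1 = K1 * T powr \<gamma>"
  have D1: "D1 \<ge> 0" using K1 by (simp add: D1_def)
  define M1 where "M1 = 2 * (X0 + a * R1 * T + D1) * exp ((2 * \<bar>k\<bar> + 1) * T)"
  have M1: "M1 \<ge> 0" using X0 a R1 D1 \<open>T > 0\<close> by (simp add: M1_def)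
  define F1 where "F1 = a * R1 + \<bar>k\<bar> * M1"
  have F1: "F1 \<ge> 0" using a R1 M1 by (simp add: F1_def)
  define c1 where "c1 = 4 / (1 - 2 powr -H)\<^sup>2"
  have c1: "c1 \<ge> 0" by (simp add: c1_def)
  define c2 where "c2 = 2 * T powr (1 - H)"
  have c2: "c2 \<ge> 0" by (simp add: c2_def)
  define O1 where "O1 = F1 * c2 + \<sigma> * c1"
  have O1: "O1 \<ge> 0" using F1 c1 c2 \<open>\<sigma> > 0\<close> by (simp add: O1_def)
  define L1 where "L1 = exp (T * max 0 (- k) / \<xi>) * T * (a * R1\<^sup>2 + \<bar>k\<bar>) + 1"
  have L1: "L1 \<ge> 0" using a \<open>T > 0\<close> by (auto simp: L1_def intro!: add_nonneg_nonneg mult_nonneg_nonneg)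
  show thesis
  proof (rule that[of "L1 * O1" "3 * r"])
    show "L1 * O1 \<ge> 0" "3 * r > 0" using L1 O1 r by auto
    fix b x :: "real \<Rightarrow> real" and N :: nat and h g g' t
    assume cb: "continuous_on {0..T} b" "b 0 = 0" and cx: "continuous_on {0..T} x"
      and px: "\<And>t. t \<in> {0..T} \<Longrightarrow> x t > 0"
      and ex: "\<And>t. t \<in> {0..T} \<Longrightarrow> x t = X0 + (LBINT s:{0..t}. 1/2 * \<kappa> * (\<theta> / x s - x s)) + 1/2 * \<sigma> * b t"
      and g: "dyadic_exp_bound T H 1 b g" "dyadic_exp_bound T H N b g'" "g \<ge> 1" "g' \<ge> 1"
      and N: "N \<ge> 2" "h = T / real N" and hk: "h * max 0 (- \<kappa> / 2) < 1 - \<xi>" and t: "t \<in> {0..T}"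
    define w where "w t = \<sigma> / 2 * b t" for t
    interpret singular_drift_path a k T X0 x w
      unfolding a_def k_def w_def[abs_def]
      using integral_equation_singular_drift_path[of T X0 \<kappa> \<theta> b x \<sigma>] assms cb cx px ex by blast
    define q q' Q where "q = 1 + ln g" and "q' = 1 + ln g'" and "Q = q powr r"
    define \<delta> where "\<delta> = h powr H * sqrt (ln (real N))"
    have q: "q \<ge> 1" "q' \<ge> 1" using g by (auto simp: q_def q'_def)
    have Q: "Q \<ge> 1" "q \<le> Q"
      using q r powr_mono[of 1 r q] by (auto simp: Q_def ge_one_powr_ge_zero)
    have hpos: "h > 0" using \<open>T > 0\<close> N by simp
    have \<delta>: "\<delta> \<ge> 0" using half_le_ln[OF N(1)] by (simp add: \<delta>_def)
    \<comment> \<open>The drift moves x by order h within a cell. Since \<open>H < 1\<close>,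
      \<open>h \<le> T\<close> and \<open>2 * sqrt (ln N) \<ge> 1\<close>, this is at most a
      constant times the noise scale \<delta>.\<close>
    have h\<delta>: "h \<le> c2 * \<delta>"
    proof -
      have "T / real N \<le> T / 1" using N(1) \<open>T > 0\<close> by (intro divide_left_mono) auto
      then have "h \<le> T" by (simp add: N)
      have "h = h powr H * h powr (1 - H)" using hpos by (simp add: powr_add[symmetric])
      also have "\<dots> \<le> h powr H * T powr (1 - H)" using hpos \<open>h \<le> T\<close> H by (intro mult_left_mono powr_mono2) auto
      also have "\<dots> \<le> h powr H * T powr (1 - H) * (2 * sqrt (ln (real N)))"
      proof -
        have "sqrt ((1/2)\<^sup>2) \<le> sqrt (ln (real N))"
          using half_le_ln[OF N(1)] by (intro real_sqrt_le_mono) (simp add: power2_eq_square)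
        then have "1 \<le> 2 * sqrt (ln (real N))" by simp
        then show ?thesis using mult_left_mono[of 1 "2 * sqrt (ln (real N))" "h powr H * T powr (1 - H)"] by simp
      qed
      finally show ?thesis by (simp add: c2_def \<delta>_def mult_ac)
    qed
    have holder: "\<bar>w t - w s\<bar> \<le> (K1 * q) * \<bar>t - s\<bar> powr \<gamma>" if "s \<in> {0..T}" "t \<in> {0..T}" for s t
    proof -
      have "\<bar>b t - b s\<bar> \<le> K0 * q * \<bar>t - s\<bar> powr \<gamma>"
        using dyadic_exp_bound_holder[OF g(1) \<open>T > 0\<close> g(3) \<gamma>0 \<gamma>(2,3) cb(1) that]
        by (simp only: K0_def q_def times_divide_eq_left times_divide_eq_right mult_ac)
      then have "\<sigma> / 2 * \<bar>b t - b s\<bar> \<le> \<sigma> / 2 * (K0 * q * \<bar>t - s\<bar> powr \<gamma>)"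
        using \<open>\<sigma> > 0\<close> by (intro mult_left_mono) auto
      moreover have "\<bar>w t - w s\<bar> = \<sigma> / 2 * \<bar>b t - b s\<bar>"
        unfolding w_def right_diff_distrib[symmetric] abs_mult using \<open>\<sigma> > 0\<close> by simp
      ultimately show ?thesis by (simp add: K1_def mult_ac)
    qed
    have R: "1 / x t \<le> R1 * Q" if t: "t \<in> {0..T}" for t
    proof -
      have "1 / x t \<le> 1 / r0 + (K1 * q / (a / 4) powr \<gamma>) powr r"
        unfolding r_def using K1 q by (intro inverse_bound[OF \<gamma>(1,3) _ holder r0 t]) auto
      also have "(K1 * q / (a / 4) powr \<gamma>) powr r = (K1 / (a / 4) powr \<gamma>) powr r * Q"
        using powr_mult[of "K1 / (a / 4) powr \<gamma>" q r] K1 q by (simp add: Q_def)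
      also have "1 / r0 \<le> 1 / r0 * Q" using Q r0 by (simp add: field_simps)
      finally show ?thesis by (simp add: R1_def algebra_simps)
    qed
    have M: "x t \<le> M1 * Q" if t: "t \<in> {0..T}" for t
    proof -
      have "\<bar>w t - w 0\<bar> \<le> D1 * Q" if t: "t \<in> {0..T}" for t
      proof -
        have "\<bar>w t - w 0\<bar> \<le> (K1 * q) * \<bar>t - 0\<bar> powr \<gamma>" using t \<open>T > 0\<close> by (intro holder) auto
        also have "\<dots> \<le> (K1 * Q) * T powr \<gamma>"
          using K1 Q q t \<gamma> by (intro mult_mono powr_mono2) auto
        finally show ?thesis by (simp add: D1_def mult_ac)
      qed
      then have "x t \<le> 2 * (X0 + a * (R1 * Q) * T + D1 * Q) * exp ((2 * \<bar>k\<bar> + 1) * T)"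
        using t by (intro upper_bound R) auto
      also have "\<dots> \<le> 2 * (X0 * Q + a * (R1 * Q) * T + D1 * Q) * exp ((2 * \<bar>k\<bar> + 1) * T)"
        using X0 Q by (intro mult_right_mono mult_left_mono[of _ _ 2] add_mono order_refl)
          (auto simp: mult_le_cancel_left1)
      also have "\<dots> = M1 * Q" by (simp add: M1_def algebra_simps)
      finally show ?thesis .
    qed
    have F: "\<bar>a / x s - k * x s\<bar> \<le> F1 * Q" if s: "s \<in> {0..T}" for s
    proof -
      have "\<bar>a / x s - k * x s\<bar> \<le> a * (1 / x s) + \<bar>k\<bar> * x s"
        using abs_triangle_ineq4[of "a / x s" "k * x s"] a px[OF s] by (simp add: abs_mult)
      also have "\<dots> \<le> a * (R1 * Q) + \<bar>k\<bar> * (M1 * Q)"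
        using a R[OF s] M[OF s] by (intro add_mono mult_left_mono) auto
      finally show ?thesis by (simp add: F1_def algebra_simps)
    qed
    have osc: "\<bar>x s - x t\<bar> \<le> O1 * (\<delta> * (Q * q'))"
      if i: "i < N" "s \<in> {real i * h..real (Suc i) * h}" "t \<in> {real i * h..real (Suc i) * h}" for i s t
    proof -
      have main: "\<bar>x t - x s\<bar> \<le> O1 * (\<delta> * (Q * q'))"
        if st: "real i * h \<le> s" "s \<le> t" "t \<le> real (Suc i) * h" for s t
      proof -
        have i0: "0 \<le> real i * h" using hpos by simp
        have "real (Suc i) * h \<le> real N * h" using i hpos by (intro mult_right_mono) auto
        also have "\<dots> = T" using N by simp
        finally have iT: "real (Suc i) * h \<le> T" .
        have bb: "\<bar>b u - b (real i * h)\<bar> \<le> c1 * \<delta> * q'" if "real i * h \<le> u" "u \<le> real (Suc i) * h" for u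
          using dyadic_exp_bound_cell_oscillation[OF g(2) \<open>T > 0\<close> _ N(1) g(4) cb(1) i(1), of u] that H N(2)
          by (simp add: c1_def \<delta>_def q'_def)
        \<comment> \<open>Both points are compared with the left end of the cell; the resulting
          factor 2 cancels the 2 in \<open>\<sigma> / 2\<close>.\<close>
        have "\<bar>b t - b s\<bar> \<le> 2 * (c1 * \<delta> * q')" using bb[of s] bb[of t] st by linarith
        then have "\<sigma> / 2 * \<bar>b t - b s\<bar> \<le> \<sigma> / 2 * (2 * (c1 * \<delta> * q'))"
          using \<open>\<sigma> > 0\<close> by (intro mult_left_mono) auto
        moreover have "\<bar>w t - w s\<bar> = \<sigma> / 2 * \<bar>b t - b s\<bar>"
          unfolding w_def right_diff_distrib[symmetric] abs_mult using \<open>\<sigma> > 0\<close> by simp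
        ultimately have ww: "\<bar>w t - w s\<bar> \<le> \<sigma> * c1 * (\<delta> * q')" by (simp add: mult_ac)
        have ts: "t - s \<le> h" using st by (simp add: algebra_simps)
        have "\<bar>x t - x s\<bar> \<le> (F1 * Q) * (t - s) + \<bar>w t - w s\<bar>"
          using st i0 iT by (intro increment_bound F) auto
        also have "\<dots> \<le> (F1 * Q) * (c2 * \<delta>) + \<sigma> * c1 * (\<delta> * q')"
          using ww ts h\<delta> F1 Q by (intro add_mono mult_left_mono) auto
        also have "\<dots> \<le> (F1 * c2) * (\<delta> * (Q * q')) + \<sigma> * c1 * (\<delta> * (Q * q'))"
        proof (rule add_mono)
          have "F1 * c2 * (\<delta> * (Q * 1)) \<le> F1 * c2 * (\<delta> * (Q * q'))"
            using F1 c2 \<delta> Q q by (intro mult_left_mono) auto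
          then show "(F1 * Q) * (c2 * \<delta>) \<le> (F1 * c2) * (\<delta> * (Q * q'))" by (simp add: mult_ac)
          have "\<sigma> * c1 * (\<delta> * (1 * q')) \<le> \<sigma> * c1 * (\<delta> * (Q * q'))"
            using c1 \<delta> Q q \<open>\<sigma> > 0\<close> by (intro mult_left_mono mult_right_mono) auto
          then show "\<sigma> * c1 * (\<delta> * q') \<le> \<sigma> * c1 * (\<delta> * (Q * q'))" by simp
        qed
        also have "\<dots> = O1 * (\<delta> * (Q * q'))" by (simp add: O1_def distrib_right)
        finally show ?thesis .
      qed
      show ?thesis
      proof (cases "s \<le> t")
        case True then show ?thesis using main[of s t] i by (simp add: abs_minus_commute)
      next
        case False then show ?thesis using main[of t s] i by simp
      qed
    qed
    have "\<bar>x t - euler_interpolation \<kappa> \<theta> \<sigma> X0 h b t\<bar>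
      \<le> (exp (T * max 0 (- k) / \<xi>) * T * (a * (R1 * Q)\<^sup>2 + \<bar>k\<bar>) + 1) * (O1 * (\<delta> * (Q * q')))"
      using N hk by (intro euler_interpolation_error[OF a_def k_def w_def _ N(2) _ \<open>0 < \<xi>\<close> R osc t]) (auto simp: k_def)
    also have "\<dots> \<le> L1 * Q\<^sup>2 * (O1 * (\<delta> * (Q * q')))"
    proof (rule mult_right_mono)
      define e where "e = exp (T * max 0 (- k) / \<xi>) * T"
      have e: "e \<ge> 0" using \<open>T > 0\<close> by (simp add: e_def)
      have Q2: "1 \<le> Q\<^sup>2" using Q by (simp add: one_le_power)
      have "e * (a * (R1 * Q)\<^sup>2 + \<bar>k\<bar>) + 1 \<le> e * (a * (R1 * Q)\<^sup>2 + \<bar>k\<bar> * Q\<^sup>2) + Q\<^sup>2"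
        using Q2 e by (intro add_mono mult_left_mono[of _ _ e] order_refl) (auto simp: mult_le_cancel_left1)
      also have "\<dots> = L1 * Q\<^sup>2" by (simp add: L1_def e_def power_mult_distrib algebra_simps)
      finally show "exp (T * max 0 (- k) / \<xi>) * T * (a * (R1 * Q)\<^sup>2 + \<bar>k\<bar>) + 1 \<le> L1 * Q\<^sup>2"
        by (simp add: e_def)
      show "0 \<le> O1 * (\<delta> * (Q * q'))" using O1 \<delta> Q q by simp
    qed
    also have "\<dots> = L1 * O1 * \<delta> * (Q ^ 3 * q')" by (simp add: power2_eq_square power3_eq_cube mult_ac)
    also have "Q ^ 3 = q powr (3 * r)" using q by (simp add: Q_def powr_power mult.commute)
    finally show "\<bar>x t - euler_interpolation \<kappa> \<theta> \<sigma> X0 h b t\<bar>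
        \<le> L1 * O1 * (h powr H * sqrt (ln (real N))) * ((1 + ln g) powr (3 * r) * (1 + ln g'))"
      by (simp add: \<delta>_def q_def q'_def)
  qed
qed

section \<open>Measurability and expectation\<close>

lemma backward_euler_measurable:
  assumes "\<And>i. i \<le> n \<Longrightarrow> B (real i * h) \<in> borel_measurable M"
  shows "(\<lambda>\<omega>. backward_euler \<kappa> \<theta> \<sigma> X0 h (\<lambda>s. B s \<omega>) n) \<in> borel_measurable M"
  using assms
proof (induction n)
  case (Suc n)
  have [measurable]: "(\<lambda>\<omega>. backward_euler \<kappa> \<theta> \<sigma> X0 h (\<lambda>s. B s \<omega>) n) \<in> borel_measurable M"
    "B (real (Suc n) * h) \<in> borel_measurable M" "B (real n * h) \<in> borel_measurable M"
    using Suc by (auto simp del: of_nat_Suc)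
  then show ?case unfolding backward_euler.simps Let_def by measurable
qed simp

lemma continuous_on_grid_interpolation: "h \<noteq> 0 \<Longrightarrow> continuous_on S (grid_interpolation h N y)"
  unfolding grid_interpolation_def[abs_def] by (intro continuous_intros) auto

lemma grid_interpolation_measurable:
  assumes "\<And>n. n \<le> N \<Longrightarrow> (\<lambda>\<omega>. y \<omega> n) \<in> borel_measurable M"
  shows "(\<lambda>\<omega>. grid_interpolation h N (y \<omega>) t) \<in> borel_measurable M"
  unfolding grid_interpolation_def using assms
  by (intro borel_measurable_add borel_measurable_sum borel_measurable_times borel_measurable_diff) auto

text \<open>Continuity reduces the uncountable supremum to the rationals of the open interval, whose
  closure is \<open>{0..T}\<close>. Compactness supplies the boundedness without which a real-valued
  \<open>SUP\<close> means nothing.\<close>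

lemma borel_measurable_continuous_SUP:
  fixes f :: "real \<Rightarrow> 'a \<Rightarrow> real"
  assumes "T > 0" and m: "\<And>t. t \<in> {0..T} \<Longrightarrow> f t \<in> borel_measurable M"
    and c: "\<And>\<omega>. \<omega> \<in> space M \<Longrightarrow> continuous_on {0..T} (\<lambda>t. f t \<omega>)"
  shows "(\<lambda>\<omega>. SUP t\<in>{0..T}. f t \<omega>) \<in> borel_measurable M"
proof -
  define D where "D = {0<..<T} \<inter> \<rat>"
  have cl: "closure D = {0..T}"
    unfolding D_def using \<open>T > 0\<close>
    by (subst closure_open_Int_superset) (auto simp: Rats_closure_real)
  have cD: "countable D" unfolding D_def using countable_rat by (rule countable_Int2)
  have DT: "D \<subseteq> {0..T}" by (auto simp: D_def)
  have Dne: "D \<noteq> {}" using cl \<open>T > 0\<close> by auto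
  have bdd: "bdd_above ((\<lambda>t. f t \<omega>) ` {0..T})" if "\<omega> \<in> space M" for \<omega>
    using compact_continuous_image[OF c[OF that] compact_Icc] by (intro bounded_imp_bdd_above compact_imp_bounded)
  have bD: "bdd_above ((\<lambda>t. f t \<omega>) ` D)" if "\<omega> \<in> space M" for \<omega>
    by (rule bdd_above_mono[OF bdd[OF that] image_mono[OF DT]])
  have "(SUP t\<in>{0..T}. f t \<omega>) = (SUP t\<in>D. f t \<omega>)" if \<omega>: "\<omega> \<in> space M" for \<omega>
  proof (rule antisym)
    show "(SUP t\<in>D. f t \<omega>) \<le> (SUP t\<in>{0..T}. f t \<omega>)"
      using bdd[OF \<omega>] DT Dne by (intro cSUP_subset_mono) auto
    have "(\<lambda>t. f t \<omega>) ` closure D \<subseteq> {..(SUP t\<in>D. f t \<omega>)}"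
      using c[OF \<omega>] bD[OF \<omega>] by (intro image_closure_subset) (auto simp: cl intro: cSUP_upper)
    then show "(SUP t\<in>{0..T}. f t \<omega>) \<le> (SUP t\<in>D. f t \<omega>)"
      using \<open>T > 0\<close> unfolding cl by (intro cSUP_least) (auto simp: image_subset_iff)
  qed
  moreover have "(\<lambda>\<omega>. SUP t\<in>D. f t \<omega>) \<in> borel_measurable M"
    using cD DT m bD by (intro borel_measurable_cSUP) auto
  ultimately show ?thesis by (subst measurable_cong[where g = "\<lambda>\<omega>. SUP t\<in>D. f t \<omega>"]) auto
qed

theorem theorem4p2:
  fixes T H \<kappa> \<theta> \<sigma> X0 \<xi> p :: real
  assumes "T > 0" and "1/2 < H" and "H < 1" and "\<kappa> * \<theta> > 0" and "\<sigma> > 0" and "X0 > 0"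
    and "0 < \<xi>" and "\<xi> < 1" and "p \<ge> 2"
    and "\<forall>s\<in>{0..T}. \<kappa> * \<theta> * exp (\<kappa> * s / 2) \<ge>
           (3 * p + 1) * (LBINT \<tau>:{0..s}. \<sigma>\<^sup>2 / 2 * exp (\<kappa> * \<tau> / 2) * fbm_kernel H \<tau> s)"
  shows "\<exists>C::real. \<forall>(M::'a measure) (B::real \<Rightarrow> 'a \<Rightarrow> real) (X::real \<Rightarrow> 'a \<Rightarrow> real) (N::nat) (h::real).
    prob_space M \<and> fractional_brownian_motion M T H B \<and> exact_solution M T \<kappa> \<theta> \<sigma> X0 B X \<and>
    N \<ge> 2 \<and> h = T / real N \<and> h < 1 \<and> h * max 0 (- \<kappa> / 2) < 1 - \<xi> \<longrightarrow>
      integrable M (\<lambda>\<omega>. SUP t\<in>{0..T}.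
        \<bar>X t \<omega> - euler_interpolation \<kappa> \<theta> \<sigma> X0 h (\<lambda>s. B s \<omega>) t\<bar> powr p) \<and>
      (LINT \<omega>|M. (SUP t\<in>{0..T}.
        \<bar>X t \<omega> - euler_interpolation \<kappa> \<theta> \<sigma> X0 h (\<lambda>s. B s \<omega>) t\<bar> powr p)) powr (1 / p)
      \<le> C * h powr H * sqrt (ln (T / h))"
proof -
  obtain C r where C: "C \<ge> 0" "r > 0" and
    path: "\<And>b x N h g g' t. continuous_on {0..T} b \<Longrightarrow> b 0 = 0 \<Longrightarrow> continuous_on {0..T} x \<Longrightarrow>
      (\<And>t. t \<in> {0..T} \<Longrightarrow> x t > 0) \<Longrightarrow>
      (\<And>t. t \<in> {0..T} \<Longrightarrow> x t = X0 + (LBINT s:{0..t}. 1/2 * \<kappa> * (\<theta> / x s - x s)) + 1/2 * \<sigma> * b t) \<Longrightarrow>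
      dyadic_exp_bound T H 1 b g \<Longrightarrow> dyadic_exp_bound T H N b g' \<Longrightarrow> g \<ge> 1 \<Longrightarrow> g' \<ge> 1 \<Longrightarrow>
      N \<ge> 2 \<Longrightarrow> h = T / real N \<Longrightarrow> h * max 0 (- \<kappa> / 2) < 1 - \<xi> \<Longrightarrow> t \<in> {0..T} \<Longrightarrow>
      \<bar>x t - euler_interpolation \<kappa> \<theta> \<sigma> X0 h b t\<bar>
        \<le> C * (h powr H * sqrt (ln (real N))) * ((1 + ln g) powr r * (1 + ln g'))"
    using pathwise_euler_error[OF assms(1-7)] by blast
  \<comment> \<open>The dependence between the two functionals is unknown, so their product is split
    by \<open>u * v \<le> u\<^sup>2 + v\<^sup>2\<close>. Squaring doubles the exponents, and
    \<open>one_plus_ln_powr_le\<close> is then used with \<open>2 * (r * p)\<close> and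
    \<open>2 * p\<close>.\<close>
  define C1 where "C1 = (1 + 2 * (r * p)) powr (2 * (r * p)) + (1 + 2 * p) powr (2 * p)"
  have C1: "C1 \<ge> 0" by (simp add: C1_def)
  have young: "((1 + ln g) powr r * (1 + ln g')) powr p \<le> C1 * (g + g')" if "g \<ge> 1" "g' \<ge> 1" for g g' :: real
  proof -
    have "((1 + ln g) powr r * (1 + ln g')) powr p = (1 + ln g) powr (r * p) * (1 + ln g') powr p"
      using that by (simp add: powr_mult powr_powr)
    also have "\<dots> \<le> ((1 + ln g) powr (r * p))\<^sup>2 + ((1 + ln g') powr p)\<^sup>2"
    proof -
      have "u * v \<le> u\<^sup>2 + v\<^sup>2" if "u \<ge> 0" "v \<ge> 0" for u v :: real
        using sum_squares_bound[of u v] mult_nonneg_nonneg[OF that] by linarith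
      then show ?thesis by simp
    qed
    also have "\<dots> = (1 + ln g) powr (2 * (r * p)) + (1 + ln g') powr (2 * p)"
      by (simp add: power2_eq_square powr_add[symmetric] mult_ac)
    also have "\<dots> \<le> (1 + 2 * (r * p)) powr (2 * (r * p)) * g + (1 + 2 * p) powr (2 * p) * g'"
      using that C \<open>p \<ge> 2\<close> by (intro add_mono one_plus_ln_powr_le) auto
    also have "\<dots> \<le> C1 * g + C1 * g'"
      using that by (intro add_mono mult_right_mono) (auto simp: C1_def)
    finally show ?thesis by (simp add: distrib_left)
  qed
  show ?thesis
  \<comment> \<open>The 10 is the sum of the two bounds 5 on the expectations of \<open>G\<close>
    and \<open>G'\<close>.\<close>
  proof (intro exI[of _ "C * (10 * C1) powr (1 / p)"] allI impI)
    fix M :: "'a measure" and B X :: "real \<Rightarrow> 'a \<Rightarrow> real" and N :: nat and h :: real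
    assume A: "prob_space M \<and> fractional_brownian_motion M T H B \<and> exact_solution M T \<kappa> \<theta> \<sigma> X0 B X \<and>
      N \<ge> 2 \<and> h = T / real N \<and> h < 1 \<and> h * max 0 (- \<kappa> / 2) < 1 - \<xi>"
    then interpret prob_space M by simp
    have B: "fractional_brownian_motion M T H B" and X: "exact_solution M T \<kappa> \<theta> \<sigma> X0 B X"
      and N: "N \<ge> 2" "h = T / real N" and hk: "h * max 0 (- \<kappa> / 2) < 1 - \<xi>" using A by auto
    have hpos: "h > 0" using N \<open>T > 0\<close> by simp
    have Th: "T / h = real N" and Nh: "real N * h = T" using N \<open>T > 0\<close> by auto
    let ?e = "\<lambda>t \<omega>. \<bar>X t \<omega> - euler_interpolation \<kappa> \<theta> \<sigma> X0 h (\<lambda>s. B s \<omega>) t\<bar> powr p"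
    let ?S = "\<lambda>\<omega>. SUP t\<in>{0..T}. ?e t \<omega>"
    have Xm: "X t \<in> borel_measurable M" if "t \<in> {0..T}" for t
      using X that by (simp add: exact_solution_def)
    have Xc: "continuous_on {0..T} (\<lambda>t. X t \<omega>)" "\<forall>t\<in>{0..T}. X t \<omega> > 0" if "\<omega> \<in> space M" for \<omega>
      using X that by (auto simp: exact_solution_def)
    have Bc: "continuous_on {0..T} (\<lambda>t. B t \<omega>)" if "\<omega> \<in> space M" for \<omega>
      using B that by (auto simp: fractional_brownian_motion_def)
    have grid: "real i * h \<in> {0..T}" if "i \<le> N" for i
      using that hpos Nh mult_right_mono[of "real i" "real N" h] by simp
    have em: "?e t \<in> borel_measurable M" if t: "t \<in> {0..T}" for t
    proof -
      have "(\<lambda>\<omega>. euler_interpolation \<kappa> \<theta> \<sigma> X0 h (\<lambda>s. B s \<omega>) t) \<in> borel_measurable M"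
      proof (subst euler_interpolation_grid[OF hpos, of t N])
        show "(\<lambda>\<omega>. grid_interpolation h N (backward_euler \<kappa> \<theta> \<sigma> X0 h (\<lambda>s. B s \<omega>)) t) \<in> borel_measurable M"
          by (intro grid_interpolation_measurable backward_euler_measurable
              fractional_brownian_motion_measurable(2)[OF B] grid) simp
      qed (use t Nh in auto)
      then show ?thesis using Xm[OF t] by measurable
    qed
    have ec: "continuous_on {0..T} (\<lambda>t. ?e t \<omega>)" if \<omega>: "\<omega> \<in> space M" for \<omega>
    proof -
      have "continuous_on {0..T} (grid_interpolation h N (backward_euler \<kappa> \<theta> \<sigma> X0 h (\<lambda>s. B s \<omega>)))"
        using hpos by (intro continuous_on_grid_interpolation) simp
      then have "continuous_on {0..T} (euler_interpolation \<kappa> \<theta> \<sigma> X0 h (\<lambda>s. B s \<omega>))"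
        using Nh by (subst continuous_on_cong[OF refl euler_interpolation_grid[OF hpos, of _ N]]) auto
      then show ?thesis
        using Xc(1)[OF \<omega>] \<open>p \<ge> 2\<close> by (intro continuous_on_powr' continuous_intros) auto
    qed
    have Sm: "?S \<in> borel_measurable M" using \<open>T > 0\<close> em ec by (rule borel_measurable_continuous_SUP)
    obtain G where G: "G \<in> borel_measurable M" "\<And>\<omega>. 1 \<le> G \<omega>" "integrable M G" "expectation G \<le> 5"
      "AE \<omega> in M. dyadic_exp_bound T H 1 (\<lambda>t. B t \<omega>) (G \<omega>)"
      using fractional_brownian_motion_dyadic_exp_bound[OF B \<open>T > 0\<close>, of 1] by auto
    obtain G' where G': "G' \<in> borel_measurable M" "\<And>\<omega>. 1 \<le> G' \<omega>" "integrable M G'" "expectation G' \<le> 5"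
      "AE \<omega> in M. dyadic_exp_bound T H N (\<lambda>t. B t \<omega>) (G' \<omega>)"
      using fractional_brownian_motion_dyadic_exp_bound[OF B \<open>T > 0\<close>, of N] N by auto
    define \<delta> where "\<delta> = h powr H * sqrt (ln (real N))"
    have \<delta>: "\<delta> \<ge> 0" using half_le_ln[OF N(1)] by (simp add: \<delta>_def)
    define K where "K = (C * \<delta>) powr p * C1"
    have K: "K \<ge> 0" using C1 by (simp add: K_def)
    have Xe: "AE \<omega> in M. \<forall>t\<in>{0..T}.
        X t \<omega> = X0 + (LBINT s:{0..t}. 1/2 * \<kappa> * (\<theta> / X s \<omega> - X s \<omega>)) + 1/2 * \<sigma> * B t \<omega>"
      using X by (simp add: exact_solution_def)
    \<comment> \<open>The exceptional null sets come from the two functionals, the integral equation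
      and the start of \<open>B\<close>. None of them depends on t, so the supremum can be taken
      path by path.\<close>
    have bound: "AE \<omega> in M. ?S \<omega> \<le> K * (G \<omega> + G' \<omega>)"
      using G(5) G'(5) Xe fractional_brownian_motion_start[OF B less_imp_le[OF \<open>T > 0\<close>]] AE_space
    proof eventually_elim
      case (elim \<omega>)
      show ?case
      proof (rule cSUP_least)
        fix t assume t: "t \<in> {0..T}"
        have "\<bar>X t \<omega> - euler_interpolation \<kappa> \<theta> \<sigma> X0 h (\<lambda>s. B s \<omega>) t\<bar>
          \<le> C * \<delta> * ((1 + ln (G \<omega>)) powr r * (1 + ln (G' \<omega>)))"
          unfolding \<delta>_def
          by (rule path[OF Bc[OF elim(5)] elim(4) Xc(1)[OF elim(5)] _ _ elim(1,2) G(2) G'(2) N hk t])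
            (use elim(3) Xc(2)[OF elim(5)] in blast)+
        then have "?e t \<omega> \<le> (C * \<delta> * ((1 + ln (G \<omega>)) powr r * (1 + ln (G' \<omega>)))) powr p"
          using \<open>p \<ge> 2\<close> by (intro powr_mono2) auto
        also have "\<dots> = (C * \<delta>) powr p * ((1 + ln (G \<omega>)) powr r * (1 + ln (G' \<omega>))) powr p"
          using C \<delta> G(2)[of \<omega>] G'(2)[of \<omega>] by (intro powr_mult) 
        also have "\<dots> \<le> (C * \<delta>) powr p * (C1 * (G \<omega> + G' \<omega>))"
          using young[OF G(2) G'(2), of \<omega> \<omega>] by (intro mult_left_mono) auto
        finally show "?e t \<omega> \<le> K * (G \<omega> + G' \<omega>)" by (simp add: K_def mult.assoc)
      qed (use \<open>T > 0\<close> in simp)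
    qed
    have S0: "0 \<le> ?S \<omega>" if \<omega>: "\<omega> \<in> space M" for \<omega>
    proof -
      have "bdd_above ((\<lambda>t. ?e t \<omega>) ` {0..T})"
        using compact_continuous_image[OF ec[OF \<omega>] compact_Icc]
        by (intro bounded_imp_bdd_above compact_imp_bounded)
      then have "?e 0 \<omega> \<le> ?S \<omega>" using \<open>T > 0\<close> by (intro cSUP_upper) auto
      then show ?thesis by (rule order_trans[rotated]) simp
    qed
    have Gi: "integrable M (\<lambda>\<omega>. K * (G \<omega> + G' \<omega>))" using G(3) G'(3) by simp
    have Si: "integrable M ?S"
    proof (rule Bochner_Integration.integrable_bound[OF Gi Sm])
      show "AE \<omega> in M. norm (?S \<omega>) \<le> norm (K * (G \<omega> + G' \<omega>))"
        using bound AE_space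
      proof eventually_elim
        case (elim \<omega>)
        then show ?case using S0[of \<omega>] by (smt (verit) real_norm_def)
      qed
    qed
    have S_nn: "0 \<le> expectation ?S" using S0 by (intro integral_nonneg_AE AE_I2)
    have "expectation ?S \<le> expectation (\<lambda>\<omega>. K * (G \<omega> + G' \<omega>))"
      using Si Gi bound by (rule integral_mono_AE)
    also have "\<dots> = K * (expectation G + expectation G')" using G(3) G'(3) by simp
    also have "\<dots> \<le> K * 10" using G(4) G'(4) K by (intro mult_left_mono) auto
    also have "\<dots> = (C * \<delta>) powr p * (10 * C1)" by (simp add: K_def)
    finally have "expectation ?S powr (1 / p) \<le> ((C * \<delta>) powr p * (10 * C1)) powr (1 / p)"
      using S_nn \<open>p \<ge> 2\<close> by (intro powr_mono2) auto
    also have "\<dots> = C * \<delta> * (10 * C1) powr (1 / p)"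
      using C \<delta> C1 \<open>p \<ge> 2\<close> by (simp add: powr_mult powr_powr)
    finally show "integrable M ?S \<and>
      expectation ?S powr (1 / p) \<le> C * (10 * C1) powr (1 / p) * h powr H * sqrt (ln (T / h))"
      using Si by (simp add: \<delta>_def Th mult_ac)
  qed
qed

end
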